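(* Assume the Elliott–Halberstam conjecture: for every fixed $0<\vartheta<1$ and every fixed $A>1$ there is a constant $C=C(\vartheta,A)$ such that for all $x\ge 2$, $$\sum_{r<x^\vartheta}\ \sup_{a\in(\mathbb Z/r\mathbb Z)^\times}\Big|\sum_{n\le x:\ n\equiv a\ (\mathrm{mod}\ r)}\Lambda(n)-\frac{x}{\phi(r)}\Big|\le C\,x\log^{-A}x .$$ Then Vinogradov's conjecture holds: for every fixed $\varepsilon>0$ there is a constant $C_\varepsilon$ such that $n(p)\le C_\varepsilon\,p^{\varepsilon}$ for every prime $p$.
   Context: $\Lambda$ is the von Mangoldt function, $\phi$ is Euler's totient function, and $(\mathbb Z/r\mathbb Z)^\times$ denotes the primitive residue classes modulo $r$. For a prime $p$, $n(p)$ denotes the least natural number that is not a quadratic residue modulo $p$. *)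

theory Defs
  imports "HOL-Analysis.Analysis" "HOL-Number_Theory.Number_Theory"
begin

definition psi_ap :: "real \<Rightarrow> nat \<Rightarrow> nat \<Rightarrow> real" where
  "psi_ap x r a = (\<Sum>n \<in> {n \<in> {1..nat \<lfloor>x\<rfloor>}. [n = a] (mod r)}. mangoldt n)"

definition units_mod :: "nat \<Rightarrow> nat set" where
  "units_mod r = {a. a < r \<and> coprime a r}"

definition elliott_halberstam :: bool where
  "elliott_halberstam \<longleftrightarrow>
     (\<forall>\<theta>::real. \<forall>A::real. 0 < \<theta> \<and> \<theta> < 1 \<and> A > 1 \<longrightarrow>
       (\<exists>C::real. \<forall>x::real. x \<ge> 2 \<longrightarrow>
          (\<Sum>r \<in> {r::nat. 1 \<le> r \<and> real r < x powr \<theta>}.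
              Max ((\<lambda>a. \<bar>psi_ap x r a - x / real (totient r)\<bar>) ` units_mod r))
          \<le> C * x * (ln x) powr (-A)))"

definition least_nonres :: "nat \<Rightarrow> nat" where
  "least_nonres p = (LEAST n::nat. \<not> QuadRes (int p) (int n))"

end

theory Submission
  imports Defs "HOL-Real_Asymp.Real_Asymp" "HOL-Complex_Analysis.Complex_Analysis"
begin

text \<open>
  Suppose that $n(p) > p^\varepsilon$ for arbitrarily large $p$, and let $\chi$ be the quadratic character
  modulo $p$, so that $\chi(n) = 1$ for $n \le p^\varepsilon$. Then $f = \mu * \chi$ is bounded and supported on
  integers without prime factors below $p^\varepsilon$. For $p^2 \le x \le p^4$ write
  $\sum_{n \le x} \Lambda(n) \chi(n) = \sum_{n \le x} \Lambda(n) \chi(n + p)$ and expand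
  $\chi(n + p) = \sum_{d \mid n + p} f(d)$. Elliott-Halberstam evaluates the contribution of
  $d < x^\vartheta$; a divisor $d \ge x^\vartheta$ can only occur if $n + p$ has no prime factor in
  $(2 x^{1 - \vartheta}, p^\varepsilon)$, which is rare by the Turan-Kubilius inequality when $\vartheta$ is close
  to $1$. The same argument with $\Lambda$ replaced by $1$ has the same main term, because
  $\phi(d) \approx d$ on the support of $f$, so $\sum_{n \le x} \Lambda(n) \chi(n) = o(x)$.

  In the limit, along a sequence of such $p$, the functions
  $S_p(z) = \frac{1}{\log p} \sum_{n \le p^4} \frac{\chi(n)}{n} n^{z / \log p}$ and their analogues $c_p$ with
  $\chi \Lambda$ in place of $\chi$ converge to entire functions $S$ and $c$ of exponential type, and
  $\chi \log = \chi * \chi \Lambda$ becomes $S' = c S$. Hence $S$ is zero free, so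
  $S(z) = e^{\alpha z + \beta}$. But $\chi(n) = 1$ for $n \le p^\varepsilon$ forces $S(-v)$ to be of size
  $1 / v$ as $v \to \infty$, a contradiction.
\<close>

section \<open>Chebyshev and Mertens bounds\<close>

text \<open>Since Lambda lives on prime powers, expanding chi(n) over the divisors of n itself gives
  nothing; the period of chi moves the expansion to n + p, whose divisors d are counted through the
  class of -p modulo d. The function f is bounded because integers up to 2 p^4 have boundedly many
  prime factors above p^eps, and constants depending on that number are harmless, as it is fixed
  together with eps. The obstacle is that the hypothesis stops short of level x. The primes q <
  p^eps compensate: f vanishes on their multiples, so they must divide the cofactor of a large d.
  For almost all n + p to have such a q, the reciprocals of the admissible primes need a large sum;
  hence their lower end x^a is chosen first, and theta is pushed to 1 - a/2 afterwards. The cutoff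
  p^4 is the square of p^2: a b > p^4 forces one variable beyond p^2, where the sums of chi (by
  periodicity) and of chi Lambda are both small. The final contradiction compares orders in S(-2v)
  S(0) = S(-v)^2: the left side is at least of order 1/v, the right at most of order 1/v^2.\<close>

lemma elliott_halberstam_shifted:
  assumes "elliott_halberstam" "0 < \<theta>" "\<theta> < 1"
  obtains C where "C \<ge> 0"
    "\<And>N h R. N \<ge> 2 \<Longrightarrow> h > 0 \<Longrightarrow> R \<subseteq> {d. 1 \<le> d \<and> real d < real N powr \<theta> \<and> coprime d h} \<Longrightarrow>
       (\<Sum>d\<in>R. \<bar>(\<Sum>n\<in>{n\<in>{1..N}. d dvd n + h}. mangoldt n) - real N * (1 / real (totient d))\<bar>)
         \<le> C * (real N * ln (real N) powr (-2))"
proof -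
  have "0 < \<theta> \<and> \<theta> < 1 \<and> (2::real) > 1" using assms by simp
  from assms(1)[unfolded elliott_halberstam_def, rule_format, OF this]
  obtain C where C: "\<And>x::real. x \<ge> 2 \<Longrightarrow>
      (\<Sum>r \<in> {r::nat. 1 \<le> r \<and> real r < x powr \<theta>}.
         Max ((\<lambda>a. \<bar>psi_ap x r a - x / real (totient r)\<bar>) ` units_mod r)) \<le> C * x * (ln x) powr (-2)"
    by blast
  have "(\<Sum>d\<in>R. \<bar>(\<Sum>n\<in>{n\<in>{1..N}. d dvd n + h}. mangoldt n) - real N * (1 / real (totient d))\<bar>)
         \<le> max C 0 * (real N * ln (real N) powr (-2))"
    if N: "N \<ge> 2" and h: "h > 0" and R: "R \<subseteq> {d. 1 \<le> d \<and> real d < real N powr \<theta> \<and> coprime d h}" for N h R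
  proof -
    let ?S = "{r::nat. 1 \<le> r \<and> real r < real N powr \<theta>}"
    let ?m = "\<lambda>r. Max ((\<lambda>a. \<bar>psi_ap (real N) r a - real N / real (totient r)\<bar>) ` units_mod r)"
    have fin: "finite ?S"
      by (rule finite_subset[of _ "{..nat \<lceil>real N powr \<theta>\<rceil>}"]) (auto, linarith)
    have finu: "finite (units_mod r)" for r by (simp add: units_mod_def)
    have m0: "0 \<le> ?m r" if "r \<in> ?S" for r
    proof -
      \<comment> \<open>\<open>1 mod r\<close> rather than 1, because the only element of
        \<open>units_mod 1\<close> is 0.\<close>
      have "1 mod r \<in> units_mod r" using that by (auto simp: units_mod_def)
      then have "\<bar>psi_ap (real N) r (1 mod r) - real N / real (totient r)\<bar> \<le> ?m r"
        by (intro Max_ge finite_imageI finu imageI)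
      then show ?thesis by linarith
    qed
    have le: "\<bar>(\<Sum>n\<in>{n\<in>{1..N}. d dvd n + h}. mangoldt n) - real N * (1 / real (totient d))\<bar> \<le> ?m d"
      if d: "d \<in> R" for d
    proof -
      \<comment> \<open>the class of $-h$ modulo $d$\<close>
      define a where "a = (h * (d - 1)) mod d"
      have d1: "d \<ge> 1" "coprime d h" using d R by auto
      have cop: "coprime (h * (d - 1)) d"
        using d1 coprime_diff_one_left_nat[of d] by (simp add: coprime_commute[of h d])
      have "a \<in> units_mod d" using d1 cop by (simp add: units_mod_def a_def)
      moreover have "[n = a] (mod d) \<longleftrightarrow> d dvd n + h" for n
      proof -
        have "[n = a] (mod d) \<longleftrightarrow> [n + h = h * (d - 1) + h] (mod d)"
          by (simp add: a_def cong_add_rcancel_nat)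
        also have "h * (d - 1) + h = h * d" using d1 by (cases d) auto
        also have "[n + h = h * d] (mod d) \<longleftrightarrow> d dvd n + h"
          by (simp add: cong_def dvd_eq_mod_eq_0)
        finally show ?thesis .
      qed
      then have "psi_ap (real N) d a = (\<Sum>n\<in>{n\<in>{1..N}. d dvd n + h}. mangoldt n)"
        by (simp add: psi_ap_def)
      ultimately show ?thesis
        by (intro Max_ge finite_imageI finu) (metis (lifting) image_eqI times_divide_eq_right mult.right_neutral)
    qed
    have "(\<Sum>d\<in>R. \<bar>(\<Sum>n\<in>{n\<in>{1..N}. d dvd n + h}. mangoldt n) - real N * (1 / real (totient d))\<bar>)
        \<le> (\<Sum>d\<in>R. ?m d)" by (rule sum_mono) (rule le)
    also have "\<dots> \<le> (\<Sum>d\<in>?S. ?m d)" using R m0 by (intro sum_mono2 fin) auto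
    also have "\<dots> \<le> C * real N * ln (real N) powr (-2)" using N by (intro C) simp
    also have "\<dots> \<le> max C 0 * (real N * ln (real N) powr (-2))"
      unfolding mult.assoc by (intro mult_right_mono) auto
    finally show ?thesis .
  qed
  then show thesis using that[of "max C 0"] by simp
qed

text \<open>Chebyshev's bound is the case of modulus 1, where the divisibility condition is void;
  the exponent 1/2 and the shift 1 are arbitrary choices. The 4 bounds
  \<open>ln (real N) powr (-2)\<close>, since the logarithm is at least 1/2 once N >= 2.\<close>

lemma chebyshev_upper:
  assumes "elliott_halberstam"
  obtains C where "C \<ge> 1" "\<And>N. (\<Sum>n=1..N. mangoldt n) \<le> C * real N"
proof -
  obtain C where C: "C \<ge> 0" "\<And>N h R. N \<ge> 2 \<Longrightarrow> h > 0 \<Longrightarrow> R \<subseteq> {d. 1 \<le> d \<and> real d < real N powr (1/2) \<and> coprime d h} \<Longrightarrow>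
       (\<Sum>d\<in>R. \<bar>(\<Sum>n\<in>{n\<in>{1..N}. d dvd n + h}. mangoldt n) - real N * (1 / real (totient d))\<bar>)
         \<le> C * (real N * ln (real N) powr (-2))"
    using elliott_halberstam_shifted[OF assms, of "1/2"] by (auto simp del: mult_minus_right)
  have "(\<Sum>n=1..N. mangoldt n) \<le> (1 + 4 * C) * real N" for N
  proof (cases "N \<ge> 2")
    case True
    have "(1::nat) < real N powr (1/2)" using True by (simp add: gr_one_powr)
    then have "\<bar>(\<Sum>n\<in>{n\<in>{1..N}. 1 dvd n + 1}. mangoldt n) - real N * (1 / real (totient 1))\<bar>
        \<le> C * (real N * ln (real N) powr (-2))"
      using C(2)[of N 1 "{1}"] True by simp
    moreover have "{n\<in>{1..N}. 1 dvd n + 1} = {1..N}" by auto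
    ultimately have "(\<Sum>n=1..N. mangoldt n) - real N \<le> C * (real N * ln (real N) powr (-2))" by simp
    moreover have "ln (real N) powr (-2) \<le> 4"
    proof -
      have "1/2 \<le> ln (real N)" using True ln2_ge_two_thirds ln_mono[of 2 "real N"] by linarith
      then have "ln (real N) powr (-2) \<le> (1/2) powr (-2)" by (intro powr_mono2') auto
      then show ?thesis by (simp add: powr_minus powr_numeral power2_eq_square)
    qed
    then have "C * (real N * ln (real N) powr (-2)) \<le> C * (real N * 4)"
      using C(1) by (intro mult_left_mono) auto
    ultimately show ?thesis by (simp add: algebra_simps)
  next
    case False
    then have "N = 0 \<or> N = 1" by auto
    then show ?thesis using C(1) by auto
  qed
  then show thesis using that[of "1 + 4 * C"] C(1) by simp
qed

section \<open>Mertens-type estimates\<close>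

lemma card_multiples: "d > 0 \<Longrightarrow> card {n\<in>{1..N}. d dvd n} = N div d"
proof -
  assume d: "d > 0"
  have "bij_betw ((*) d) {1..N div d} {n\<in>{1..N}. d dvd n}"
    using d by (intro bij_betw_byWitness[of _ "\<lambda>n. n div d"])
      (auto simp: div_le_mono less_eq_div_iff_mult_less_eq mult.commute Suc_le_eq elim!: dvdE)
  then show ?thesis using bij_betw_same_card by fastforce
qed

text \<open>Chebyshev's expansion of log N!: write ln n as the sum of Lambda over the divisors of n
  and exchange the order. Comparing it with N ln N yields both Mertens bounds.\<close>

lemma sum_ln_eq_sum_mangoldt: "(\<Sum>n=1..N. ln (real n)) = (\<Sum>d=1..N. mangoldt d * real (N div d))"
proof -
  have "(\<Sum>n=1..N. ln (real n)) = (\<Sum>n=1..N. \<Sum>d=1..N. if d dvd n then mangoldt d else 0)"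
  proof (rule sum.cong[OF refl])
    fix n assume n: "n \<in> {1..N}"
    have "ln (real n) = (\<Sum>d | d dvd n. mangoldt d :: real)" using n by (subst mangoldt_sum) auto
    also have "{d. d dvd n} = {d\<in>{1..N}. d dvd n}" using n by (auto dest: dvd_imp_le intro!: Nat.gr0I simp: Suc_le_eq)
    also have "(\<Sum>d\<in>{d\<in>{1..N}. d dvd n}. mangoldt d) = (\<Sum>d=1..N. if d dvd n then mangoldt d else 0)"
      by (rule sum.inter_filter) simp
    finally show "ln (real n) = (\<Sum>d=1..N. if d dvd n then mangoldt d else 0)" .
  qed
  also have "\<dots> = (\<Sum>d=1..N. \<Sum>n=1..N. if d dvd n then mangoldt d else 0)" by (rule sum.swap)
  also have "\<dots> = (\<Sum>d=1..N. mangoldt d * real (N div d))"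
  proof (rule sum.cong[OF refl])
    fix d assume d: "d \<in> {1..N}"
    have "(\<Sum>n=1..N. if d dvd n then mangoldt d else 0) = (\<Sum>n\<in>{n\<in>{1..N}. d dvd n}. mangoldt d :: real)"
      by (rule sum.inter_filter[symmetric]) simp
    also have "\<dots> = mangoldt d * real (card {n\<in>{1..N}. d dvd n})" by simp
    finally show "(\<Sum>n=1..N. if d dvd n then mangoldt d else 0) = mangoldt d * real (N div d)"
      using d card_multiples[of d N] by simp
  qed
  finally show ?thesis .
qed

text \<open>Weak Stirling bound: the inductive step amounts to n (ln (n + 1) - ln n) <= 1.\<close>

lemma sum_ln_ge: "N > 0 \<Longrightarrow> real N * ln (real N) - real N \<le> (\<Sum>n=1..N. ln (real n))"
proof (induction N rule: nat_induct_non_zero)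
  case (Suc n)
  have "ln (real (Suc n)) - ln (real n) = ln (1 + 1 / real n)"
  proof -
    have "1 + 1 / real n = real (Suc n) / real n" using Suc.hyps by (simp add: field_simps)
    then show ?thesis using Suc.hyps ln_div[of "real (Suc n)" "real n"] by simp
  qed
  also have "\<dots> \<le> 1 / real n" using Suc.hyps by (intro ln_add_one_self_le_self) simp
  finally have "real n * (ln (real (Suc n)) - ln (real n)) \<le> 1" using Suc.hyps by (simp add: field_simps)
  then show ?case using Suc.IH by (simp add: algebra_simps)
qed simp

text \<open>The loss of 2 consists of 1 from Stirling and of ln 2 < 1 from replacing x by its
  integer part.\<close>

lemma mertens_lower:
  assumes "x \<ge> 1"
  shows "ln x - 2 \<le> (\<Sum>n=1..nat \<lfloor>x\<rfloor>. mangoldt n / real n)"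
proof -
  define N where "N = nat \<lfloor>x\<rfloor>"
  have N: "N > 0" "x < real N + 1" using assms by (auto simp: N_def le_nat_iff)
  have "real N * ln (real N) - real N \<le> (\<Sum>d=1..N. mangoldt d * real (N div d))"
    using sum_ln_ge[OF N(1)] unfolding sum_ln_eq_sum_mangoldt .
  also have "\<dots> \<le> (\<Sum>d=1..N. mangoldt d * (real N / real d))"
    by (intro sum_mono mult_left_mono) (auto simp: mangoldt_nonneg of_nat_div_le_of_nat)
  also have "\<dots> = real N * (\<Sum>d=1..N. mangoldt d / real d)" by (simp add: sum_distrib_left mult.commute)
  finally have "real N * (ln (real N) - 1) \<le> real N * (\<Sum>d=1..N. mangoldt d / real d)"
    by (simp add: algebra_simps)
  then have 1: "ln (real N) - 1 \<le> (\<Sum>d=1..N. mangoldt d / real d)" using N(1) by simp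
  have "x \<le> 2 * real N" using N by (cases N) auto
  then have "ln x \<le> ln (2 * real N)" using assms by (intro ln_mono) auto
  also have "\<dots> \<le> 1 + ln (real N)" using N ln_2_less_1 by (simp add: ln_mult)
  finally show ?thesis using 1 unfolding N_def by linarith
qed

text \<open>Replacing N / d by its floor costs at most 1 for each d, hence in total the sum of
  Lambda up to N, which is at most C N by Chebyshev.\<close>

lemma mertens_upper:
  assumes "\<And>N. (\<Sum>n=1..N. mangoldt n) \<le> C * real N" "x \<ge> 1"
  shows "(\<Sum>n=1..nat \<lfloor>x\<rfloor>. mangoldt n / real n) \<le> ln x + C"
proof -
  define N where "N = nat \<lfloor>x\<rfloor>"
  have N: "N > 0" "real N \<le> x" using assms(2) by (auto simp: N_def le_nat_iff)
  have "real N * (\<Sum>d=1..N. mangoldt d / real d) = (\<Sum>d=1..N. mangoldt d * (real N / real d))"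
    by (simp add: sum_distrib_left mult.commute)
  also have "\<dots> \<le> (\<Sum>d=1..N. mangoldt d * (real (N div d) + 1))"
  proof (intro sum_mono mult_left_mono mangoldt_nonneg)
    fix d assume "d \<in> {1..N}"
    then have "d > 0" by simp
    have "N < d * (N div d + 1)" using \<open>d > 0\<close> by (metis dividend_less_times_div mult_Suc_right Suc_eq_plus1 add.commute)
    then have "real N \<le> real d * (real (N div d) + 1)"
      by (metis less_imp_le of_nat_1 of_nat_add of_nat_le_iff of_nat_mult)
    then show "real N / real d \<le> real (N div d) + 1" using \<open>d > 0\<close> by (simp add: field_simps)
  qed
  also have "\<dots> = (\<Sum>n=1..N. ln (real n)) + (\<Sum>n=1..N. mangoldt n)"
    unfolding sum_ln_eq_sum_mangoldt by (simp add: distrib_left sum.distrib)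
  also have "\<dots> \<le> (\<Sum>n=1..N. ln x) + C * real N"
    using N by (intro add_mono assms(1) sum_mono ln_mono) auto
  finally have "real N * (\<Sum>d=1..N. mangoldt d / real d) \<le> real N * (ln x + C)" by (simp add: algebra_simps)
  then show ?thesis using N(1) unfolding N_def[symmetric] by simp
qed

text \<open>The powers p^k with k >= 2 form a geometric series of size at most 2 ln p / p^2, and ln
  p <= 2 sqrt p makes the sum over p converge. This lets the Mertens estimates pass from Lambda to
  primes.\<close>

lemma mangoldt_nonprime_sum_bounded:
  obtains P where "\<And>X. (\<Sum>n\<in>{n\<in>{1..X}. \<not> prime n}. mangoldt n / real n :: real) \<le> P"
proof -
  define P where "P = (\<Sum>n. 4 * real n powr (-3/2))"
  have sm: "summable (\<lambda>n. 4 * real n powr (-3/2))"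
    by (intro summable_mult) (simp add: summable_real_powr_iff)
  have "(\<Sum>n\<in>{n\<in>{1..X}. \<not> prime n}. mangoldt n / real n) \<le> P" for X
  proof -
    define I where "I = {p\<in>{2..X}. prime p} \<times> {..X}"
    let ?g = "\<lambda>(p, k). p ^ (k + 2) :: nat"
    have fin: "finite I" by (simp add: I_def)
    have sub: "{n\<in>{1..X}. \<not> prime n \<and> primepow n} \<subseteq> ?g ` I"
    proof
      fix n assume n: "n \<in> {n\<in>{1..X}. \<not> prime n \<and> primepow n}"
      then obtain p k where pk: "prime p" "k > 0" "n = p ^ k"
        by (auto simp: primepow_def)
      have "k \<noteq> 1" using n pk by auto
      then obtain j where j: "k = j + 2" using pk(2)
        by (metis One_nat_def Suc_eq_plus1 add_2_eq_Suc' not0_implies_Suc not_gr_zero)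
      have "p \<le> n" using pk by (metis One_nat_def Suc_leI dvd_imp_le dvd_power prime_gt_0_nat zero_less_power)
      moreover have "k < n" using pk prime_ge_2_nat[OF pk(1)] by (metis less_exp less_le_trans power_mono zero_le_numeral)
      ultimately have "(p, j) \<in> I" using n pk(1) j prime_ge_2_nat[OF pk(1)] by (auto simp: I_def)
      then show "n \<in> ?g ` I" using pk(3) j by (intro image_eqI[where x = "(p, j)"]) auto
    qed
    have "(\<Sum>n\<in>{n\<in>{1..X}. \<not> prime n}. mangoldt n / real n)
        = (\<Sum>n\<in>{n\<in>{1..X}. \<not> prime n \<and> primepow n}. mangoldt n / real n)"
      by (intro sum.mono_neutral_right) (auto simp: mangoldt_def)
    also have "\<dots> \<le> (\<Sum>n\<in>?g ` I. mangoldt n / real n)"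
      using fin sub by (intro sum_mono2) (auto simp: mangoldt_nonneg)
    also have "\<dots> \<le> (\<Sum>i\<in>I. ((\<lambda>n. mangoldt n / real n) \<circ> ?g) i)"
      by (intro sum_image_le fin) (auto simp: mangoldt_nonneg)
    also have "\<dots> = (\<Sum>p\<in>{p\<in>{2..X}. prime p}. \<Sum>k\<in>{..X}. ln (real p) / real p ^ (k + 2))"
      unfolding I_def sum.cartesian_product by (intro sum.cong) (auto simp del: power_Suc)
    also have "\<dots> \<le> (\<Sum>p\<in>{p\<in>{2..X}. prime p}. 4 * real p powr (-3/2))"
    proof (rule sum_mono)
      fix p assume "p \<in> {p\<in>{2..X}. prime p}"
      then have p: "p \<ge> 2" by simp
      have "(\<Sum>k\<in>{..X}. ln (real p) / real p ^ (k + 2)) = ln (real p) / real p ^ 2 * (\<Sum>k\<in>{..X}. (1 / real p) ^ k)"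
        by (subst sum_distrib_left, intro sum.cong refl) (simp add: power_divide power2_eq_square)
      also have "\<dots> \<le> ln (real p) / real p ^ 2 * 2"
      proof (rule mult_left_mono)
        have "(\<Sum>k\<in>{..X}. (1 / real p) ^ k) \<le> (\<Sum>k\<in>{..X}. (1 / 2) ^ k)"
          using p by (intro sum_mono power_mono) (auto simp: field_simps)
        also have "\<dots> \<le> (\<Sum>k. (1 / 2) ^ k)" by (intro sum_le_suminf) auto
        also have "\<dots> = (2::real)" by (subst suminf_geometric) auto
        finally show "(\<Sum>k\<in>{..X}. (1 / real p) ^ k) \<le> 2" .
      qed (use p in auto)
      also have "\<dots> \<le> (2 * real p powr (1/2)) / real p ^ 2 * 2"
      proof (intro mult_right_mono divide_right_mono)
        have "ln (real p) = 2 * ln (real p powr (1/2))" using p by (simp add: ln_powr)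
        also have "\<dots> \<le> 2 * real p powr (1/2)" using p ln_bound[of "real p powr (1/2)"] by simp
        finally show "ln (real p) \<le> 2 * real p powr (1/2)" .
      qed auto
      also have "\<dots> = 4 * (real p powr (1/2) / real p powr 2)" using p by (simp add: powr_numeral)
      also have "\<dots> = 4 * real p powr (-3/2)" unfolding powr_diff[symmetric] by simp
      finally show "(\<Sum>k\<in>{..X}. ln (real p) / real p ^ (k + 2)) \<le> 4 * real p powr (-3/2)" .
    qed
    also have "\<dots> \<le> P" unfolding P_def by (intro sum_le_suminf sm) auto
    finally show ?thesis .
  qed
  then show thesis using that by blast
qed

text \<open>Mertens leaves a mass of ln u - O(1) for Lambda(n) / n on (u, u^2], proper prime powers
  take O(1) of it, and ln q <= 2 ln u on this interval. The resulting lower bound tends to 1/2; the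
  value 1/4 leaves room for the error.\<close>

lemma prime_reciprocal_block:
  assumes "\<And>N. (\<Sum>n=1..N. mangoldt n) \<le> C * real N"
  obtains t0 :: real where "t0 > 1" "\<And>u. u \<ge> t0 \<Longrightarrow> (\<Sum>q\<in>{q. prime q \<and> u < real q \<and> real q \<le> u\<^sup>2}. 1 / real q) \<ge> 1 / 4"
proof -
  obtain P where P: "\<And>X. (\<Sum>n\<in>{n\<in>{1..X}. \<not> prime n}. mangoldt n / real n :: real) \<le> P"
    using mangoldt_nonprime_sum_bounded by blast
  \<comment> \<open>Collects C, P and the 2 of \<open>mertens_lower\<close>;
    \<open>ln u >= 2 * K\<close> makes this loss at most half of ln u. The lower cap 1 ensures u >
    1.\<close>
  define K where "K = max 1 (C + P + 2)"
  have "(\<Sum>q\<in>{q. prime q \<and> u < real q \<and> real q \<le> u\<^sup>2}. 1 / real q) \<ge> 1 / 4" if u: "u \<ge> exp (2 * K)" for u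
  proof -
    define X where "X = nat \<lfloor>u\<^sup>2\<rfloor>"
    define Y where "Y = nat \<lfloor>u\<rfloor>"
    let ?Q = "{q. prime q \<and> u < real q \<and> real q \<le> u\<^sup>2}"
    have u1: "u > 1" using u one_less_exp_iff[of "2 * K"] by (simp add: K_def del: one_less_exp_iff) 
    have lnu: "ln u \<ge> 2 * K" using u u1 by (simp add: ln_ge_iff)
    have u2: "u \<le> u\<^sup>2" using u1 by (simp add: power2_eq_square)
    have YX: "Y \<le> X" unfolding X_def Y_def using u2 by (intro nat_mono floor_mono)
    have mem: "n \<le> X \<longleftrightarrow> real n \<le> u\<^sup>2" "n \<le> Y \<longleftrightarrow> real n \<le> u" for n
      using u1 by (auto simp: X_def Y_def le_nat_iff le_floor_iff)
    have finQ: "finite ?Q" by (rule finite_subset[of _ "{..X}"]) (auto simp: mem)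
    have "2 * ln u - 2 \<le> (\<Sum>n=1..X. mangoldt n / real n)"
      using mertens_lower[of "u\<^sup>2"] u1 u2 by (simp add: X_def ln_realpow)
    also have "{1..X} = {1..Y} \<union> {n\<in>{1..X}. u < real n}" using u2 by (auto simp: mem)
    also have "(\<Sum>n\<in>\<dots>. mangoldt n / real n) = (\<Sum>n=1..Y. mangoldt n / real n) + (\<Sum>n\<in>{n\<in>{1..X}. u < real n}. mangoldt n / real n)"
      by (rule sum.union_disjoint) (auto simp: mem(2))
    also have "(\<Sum>n=1..Y. mangoldt n / real n) \<le> ln u + C"
      unfolding Y_def using u1 by (intro mertens_upper assms) auto
    also have "{n\<in>{1..X}. u < real n} = ?Q \<union> {n\<in>{1..X}. u < real n \<and> \<not> prime n}"
      by (auto simp: mem Suc_le_eq prime_gt_0_nat)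
    also have "(\<Sum>n\<in>\<dots>. mangoldt n / real n) = (\<Sum>n\<in>?Q. mangoldt n / real n) + (\<Sum>n\<in>{n\<in>{1..X}. u < real n \<and> \<not> prime n}. mangoldt n / real n)"
      using finQ by (intro sum.union_disjoint) auto
    also have "(\<Sum>n\<in>{n\<in>{1..X}. u < real n \<and> \<not> prime n}. mangoldt n / real n) \<le> P"
      by (rule order_trans[OF _ P[of X]], rule sum_mono2) (auto simp: mangoldt_nonneg)
    also have "(\<Sum>n\<in>?Q. mangoldt n / real n) \<le> (\<Sum>q\<in>?Q. 2 * ln u * (1 / real q))"
    proof (rule sum_mono)
      fix q assume q: "q \<in> ?Q"
      then have "ln (real q) \<le> ln (u\<^sup>2)" using prime_gt_0_nat[of q] by (intro ln_mono) auto
      then have "ln (real q) \<le> 2 * ln u" using u1 by (simp add: ln_realpow)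
      then show "mangoldt q / real q \<le> 2 * ln u * (1 / real q)"
        using q by (auto intro: divide_right_mono)
    qed
    also have "\<dots> = 2 * ln u * (\<Sum>q\<in>?Q. 1 / real q)" by (rule sum_distrib_left[symmetric])
    finally have "ln u - K \<le> 2 * ln u * (\<Sum>q\<in>?Q. 1 / real q)" by (simp add: K_def)
    moreover have "ln u / 2 \<le> ln u - K" using lnu by simp
    ultimately have "2 * ln u * (1 / 4) \<le> 2 * ln u * (\<Sum>q\<in>?Q. 1 / real q)" by simp
    moreover have "ln u > 0" using u1 by simp
    ultimately show ?thesis by simp
  qed
  moreover have "exp (2 * K) > 1" by (simp add: K_def)
  ultimately show thesis using that by blast
qed

text \<open>Each squaring adds a block worth 1/4, so 4 M squarings suffice; starting from x^a with a
  = b / 2^j, they end exactly at x^b.\<close>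

lemma prime_reciprocal_sum_large:
  assumes "\<And>N. (\<Sum>n=1..N. mangoldt n) \<le> C * real N" "0 < b"
  obtains a where "0 < a" "a < b"
    "eventually (\<lambda>x::real. (\<Sum>q\<in>{q. prime q \<and> x powr a < real q \<and> real q \<le> x powr b}. 1 / real q) \<ge> M) at_top"
proof -
  obtain t0 :: real where t0: "t0 > 1" "\<And>u. u \<ge> t0 \<Longrightarrow> (\<Sum>q\<in>{q. prime q \<and> u < real q \<and> real q \<le> u\<^sup>2}. 1 / real q) \<ge> 1 / 4"
    using prime_reciprocal_block[OF assms(1)] by blast
  have *: "(\<Sum>q\<in>{q. prime q \<and> u < real q \<and> real q \<le> u ^ (2 ^ j)}. 1 / real q) \<ge> real j / 4" if "u \<ge> t0" for u j
  proof (induction j)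
    case 0 show ?case by (simp add: sum_nonneg)
  next
    case (Suc j)
    define v where "v = u ^ (2 ^ j)"
    have u1: "u > 1" using that t0 by simp
    have v: "v \<ge> u" unfolding v_def using u1 self_le_power[of u "2 ^ j"] by simp
    have v2: "u ^ (2 ^ Suc j) = v\<^sup>2" by (simp add: v_def power_mult[symmetric] mult.commute)
    have vv: "v \<le> v\<^sup>2" using v u1 by (simp add: power2_eq_square)
    have fin: "finite {q. prime q \<and> s < real q \<and> real q \<le> t}" for s t :: real
      by (rule finite_subset[of _ "{..nat \<lfloor>t\<rfloor>}"]) (auto simp: le_nat_floor)
    have "{q. prime q \<and> u < real q \<and> real q \<le> v\<^sup>2}
        = {q. prime q \<and> u < real q \<and> real q \<le> v} \<union> {q. prime q \<and> v < real q \<and> real q \<le> v\<^sup>2}"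
      using v vv by auto
    then have "(\<Sum>q\<in>{q. prime q \<and> u < real q \<and> real q \<le> v\<^sup>2}. 1 / real q)
       = (\<Sum>q\<in>{q. prime q \<and> u < real q \<and> real q \<le> v}. 1 / real q) + (\<Sum>q\<in>{q. prime q \<and> v < real q \<and> real q \<le> v\<^sup>2}. 1 / real q)"
      by (simp only:) (intro sum.union_disjoint fin, auto)
    moreover have "(\<Sum>q\<in>{q. prime q \<and> v < real q \<and> real q \<le> v\<^sup>2}. 1 / real q) \<ge> 1 / 4"
      using v that by (intro t0(2)) simp
    ultimately show ?case using Suc.IH v2 by (simp add: v_def)
  qed
  define j where "j = nat \<lceil>4 * M\<rceil> + 1"
  define a where "a = b / 2 ^ j"
  have j: "real j / 4 \<ge> M" using real_nat_ceiling_ge[of "4 * M"] unfolding j_def by simp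
  have a: "0 < a" "a < b" using assms(2) one_less_power[of "2::real" j] by (auto simp: a_def j_def field_simps)
  have "eventually (\<lambda>x::real. x powr a \<ge> t0) at_top" using a(1) by real_asymp
  then have "eventually (\<lambda>x::real. (\<Sum>q\<in>{q. prime q \<and> x powr a < real q \<and> real q \<le> x powr b}. 1 / real q) \<ge> M) at_top"
    using eventually_gt_at_top[of 0]
  proof eventually_elim
    case (elim x)
    have "(x powr a) ^ (2 ^ j) = x powr b"
      using elim by (simp add: powr_realpow[symmetric] powr_powr a_def)
    then show ?case using *[OF elim(1), of j] j by simp
  qed
  then show thesis using that a by blast
qed

section \<open>Moebius transform of a completely multiplicative sign function\<close>

text \<open>The Dirichlet convolution of mu and g, obtained by solving the divisor sum relation for
  its top term.\<close>

function moebius_transform :: "(nat \<Rightarrow> real) \<Rightarrow> nat \<Rightarrow> real" where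
  "moebius_transform g m = g m - (\<Sum>d\<in>{d. d dvd m \<and> d < m}. moebius_transform g d)"
  by auto
termination by (relation "Wellfounded.measure snd") auto

declare moebius_transform.simps [simp del]

lemma sum_moebius_transform:
  assumes "m > 0"
  shows "(\<Sum>d | d dvd m. moebius_transform g d) = g m"
proof -
  have "{d. d dvd m} = insert m {d. d dvd m \<and> d < m}"
    using assms by (auto dest: dvd_imp_le)
  moreover have "finite {d. d dvd m \<and> d < m}" by simp
  ultimately show ?thesis
    by (simp add: moebius_transform.simps[of g m])
qed

section \<open>Rough numbers and their divisors\<close>

definition rough :: "real \<Rightarrow> nat \<Rightarrow> bool" where
  "rough y d \<longleftrightarrow> (\<forall>q. prime q \<longrightarrow> q dvd d \<longrightarrow> y \<le> real q)"

lemma roughD: "rough y d \<Longrightarrow> prime q \<Longrightarrow> q dvd d \<Longrightarrow> y \<le> real q"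
  by (auto simp: rough_def)

lemma rough_dvd: "rough y d \<Longrightarrow> e dvd d \<Longrightarrow> rough y e"
  unfolding rough_def using dvd_trans by blast

lemma prime_dvd_mult_not_dvd:
  fixes q d n :: nat
  assumes "prime q" "d dvd q * n" "\<not> q dvd d"
  shows "d dvd n"
  using assms by (metis coprime_commute coprime_dvd_mult_right_iff prime_imp_coprime)

lemma divisors_prime_mult_subset:
  fixes q n :: nat
  assumes "prime q"
  shows "{d. d dvd q * n \<and> rough y d} \<subseteq> {d. d dvd n \<and> rough y d} \<union> (*) q ` {d. d dvd n \<and> rough y d}"
proof
  fix d assume d: "d \<in> {d. d dvd q * n \<and> rough y d}"
  show "d \<in> {d. d dvd n \<and> rough y d} \<union> (*) q ` {d. d dvd n \<and> rough y d}"
  proof (cases "q dvd d")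
    case True
    then obtain e where e: "d = q * e" by auto
    have "q > 0" using assms by (rule prime_gt_0_nat)
    then have "e dvd n" using d e by simp
    moreover have "rough y e" using d e by (intro rough_dvd[of y d e]) auto
    ultimately have "e \<in> {d. d dvd n \<and> rough y d}" by simp
    then show ?thesis unfolding e by (rule imageI[THEN UnI2])
  next
    case False
    then have "d dvd n" using d prime_dvd_mult_not_dvd[OF assms, of d n] by blast
    then show ?thesis using d by blast
  qed
qed

text \<open>The number m has at most k prime factors >= y, counted with multiplicity. The induction
  strips one prime: a prime below y divides no rough divisor, a larger one at most doubles their
  number and lowers k by one.\<close>

lemma card_rough_divisors_le:
  assumes "y > 1" "m > 0" "real m < y ^ Suc k"
  shows "card {d. d dvd m \<and> rough y d} \<le> 2 ^ k"
  using assms(2,3)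
proof (induction m arbitrary: k rule: less_induct)
  case (less m)
  show ?case
  proof (cases "m = 1")
    case True
    have "{d. d dvd m \<and> rough y d} \<subseteq> {1}" using True by auto
    from card_mono[OF _ this] have "card {d. d dvd m \<and> rough y d} \<le> 1" by simp
    also have "(1::nat) \<le> 2 ^ k" by simp
    finally show ?thesis .
  next
    case False
    then obtain q where q: "prime q" "q dvd m" using prime_factor_nat by blast
    then obtain n where n: "m = q * n" by auto
    have n0: "n > 0" "n < m" using less.prems n prime_gt_1_nat[OF q(1)] by auto
    let ?R = "\<lambda>m. {d. d dvd m \<and> rough y d}"
    have fin: "finite (?R n)" using n0 by simp
    show ?thesis
    proof (cases "y \<le> real q")
      case False
      have "?R m \<subseteq> ?R n"
      proof
        fix d assume "d \<in> ?R m"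
        with False n q show "d \<in> ?R n"
          using prime_dvd_mult_not_dvd[of q d n] roughD[of y d q] by blast
      qed
      then have "card (?R m) \<le> card (?R n)" using fin by (rule card_mono[rotated])
      also have "\<dots> \<le> 2 ^ k" using less.IH[OF n0(2,1), of k] less.prems n0(2) by simp
      finally show ?thesis .
    next
      case True
      have *: "y * real n < y * y ^ k"
        using mult_right_mono[OF True, of "real n"] less.prems(2) n by simp
      then have lt: "real n < y ^ k" using assms(1) by simp
      with n0 have "k \<noteq> 0" by (intro notI) auto
      then obtain j where j: "k = Suc j" using not0_implies_Suc by blast
      have "card (?R m) \<le> card (?R n \<union> (*) q ` ?R n)"
        using divisors_prime_mult_subset[OF q(1), of n y] fin n by (intro card_mono) auto
      also have "\<dots> \<le> card (?R n) + card (?R n)"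
        using card_Un_le[of "?R n" "(*) q ` ?R n"] card_image_le[OF fin, of "(*) q"] by linarith
      also have "\<dots> \<le> 2 ^ k" using less.IH[OF n0(2,1), of j] lt j by simp
      finally show ?thesis .
    qed
  qed
qed

locale sign_function =
  fixes g :: "nat \<Rightarrow> real"
  assumes mult: "m > 0 \<Longrightarrow> n > 0 \<Longrightarrow> g (m * n) = g m * g n"
    and abs_eq_1: "m > 0 \<Longrightarrow> \<bar>g m\<bar> = 1"
begin

abbreviation "f \<equiv> moebius_transform g"

text \<open>For m = q n the values g m and g n agree, so the divisors of m that do not divide n
  contribute 0 in total. All of them are multiples of q, hence by induction every term except that
  of m itself vanishes.\<close>

lemma moebius_transform_eq_0:
  assumes "prime q" "g q = 1" "q dvd m" "m > 0"
  shows "f m = 0"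
  using assms(3,4)
proof (induction m rule: less_induct)
  case (less m)
  from less.prems obtain n where n: "m = q * n" by auto
  have q0: "q > 1" using assms(1) prime_gt_1_nat by blast
  have n0: "n > 0" "n < m" using n less.prems q0 by auto
  have fin: "finite {d. d dvd m}" using less.prems by simp
  have "(\<Sum>d | d dvd m. f d) = (\<Sum>d | d dvd n. f d)"
    using sum_moebius_transform[of m g] sum_moebius_transform[of n g] less.prems n n0 mult[of q n] q0 assms(2) by simp
  moreover have "(\<Sum>d | d dvd m. f d) = (\<Sum>d | d dvd n. f d) + (\<Sum>d\<in>{d. d dvd m} - {d. d dvd n}. f d)"
    using fin n by (subst sum.subset_diff[of "{d. d dvd n}"]) auto
  ultimately have z: "(\<Sum>d\<in>{d. d dvd m} - {d. d dvd n}. f d) = 0" by simp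
  have "(\<Sum>d\<in>{d. d dvd m} - {d. d dvd n}. f d) = (\<Sum>d\<in>{m}. f d)"
  proof (rule sum.mono_neutral_right)
    show "finite ({d. d dvd m} - {d. d dvd n})" using fin by auto
    show "{m} \<subseteq> {d. d dvd m} - {d. d dvd n}" using n0 by (auto dest: dvd_imp_le)
    show "\<forall>i\<in>{d. d dvd m} - {d. d dvd n} - {m}. f i = 0"
    proof
      fix i assume i: "i \<in> {d. d dvd m} - {d. d dvd n} - {m}"
      then have "i dvd m" "i \<noteq> m" "\<not> i dvd n" by auto
      moreover have "q dvd i" using prime_dvd_mult_not_dvd[OF assms(1)] n calculation by blast
      moreover have "i > 0" "i \<le> m" using calculation less.prems by (auto intro: Nat.gr0I dvd_imp_le)
      ultimately show "f i = 0" using less.IH[of i] by simp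
    qed
  qed
  with z show ?case by simp
qed

lemma moebius_transform_rough:
  assumes "\<And>q. prime q \<Longrightarrow> real q < y \<Longrightarrow> g q = 1" "m > 0" "f m \<noteq> 0"
  shows "rough y m"
  using assms moebius_transform_eq_0 unfolding rough_def by (meson not_le)

text \<open>If f m is nonzero, m is rough, so every proper divisor is smaller by a factor of at
  least y and falls under the previous k, and there are at most 2^(k+1) divisors. From a bound b for
  k this yields 1 + 2^(k+1) b <= 2^(k+2) b for k + 1 when b >= 1, and 4^(k^2) grows at least this
  fast.\<close>

lemma abs_moebius_transform_le:
  assumes "y > 1" "\<And>q. prime q \<Longrightarrow> real q < y \<Longrightarrow> g q = 1" "m > 0" "real m < y ^ Suc k"
  shows "\<bar>f m\<bar> \<le> 4 ^ k\<^sup>2"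
  using assms(3,4)
proof (induction k arbitrary: m)
  case 0
  show ?case
  proof (cases "f m = 0")
    case False
    then have r: "rough y m" using moebius_transform_rough assms 0 by blast
    have "m = 1"
    proof (rule ccontr)
      assume "m \<noteq> 1"
      then obtain q where q: "prime q" "q dvd m" using prime_factor_nat by blast
      then have "y \<le> real q" "q \<le> m" using r 0 by (auto intro: roughD dvd_imp_le)
      with 0 show False by simp
    qed
    then show ?thesis using abs_eq_1[of 1] sum_moebius_transform[of 1 g] by simp
  qed simp
next
  case (Suc k)
  show ?case
  proof (cases "f m = 0")
    case False
    then have r: "rough y m" using moebius_transform_rough assms Suc.prems by blast
    let ?S = "{d. d dvd m \<and> d < m}"
    have fd: "\<bar>f d\<bar> \<le> 4 ^ k\<^sup>2" if d: "d \<in> ?S" for d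
    proof -
      obtain c where c: "m = d * c" using d by auto
      have d0: "d > 0" using d Suc.prems by (auto intro: Nat.gr0I)
      have "c \<noteq> 1" using c d by auto
      then obtain q where q: "prime q" "q dvd c" using prime_factor_nat by blast
      have "y \<le> real q" using r q c by (auto intro: roughD)
      also have "real q \<le> real c" using q c Suc.prems by (auto intro: dvd_imp_le)
      finally have "real d * y \<le> real d * real c" by (simp add: mult_left_mono)
      also have "\<dots> < y ^ Suc k * y" using Suc.prems c by (simp add: mult.commute)
      finally have "real d < y ^ Suc k" using assms(1) by (simp add: mult.commute)
      then show ?thesis using Suc.IH d0 by blast
    qed
    have "card ?S \<le> card {d. d dvd m \<and> rough y d}"
      using Suc.prems r by (intro card_mono) (auto intro: rough_dvd)
    also have "\<dots> \<le> 2 ^ Suc k" using card_rough_divisors_le assms Suc.prems by blast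
    finally have card: "real (card ?S) \<le> 2 ^ Suc k"
      by (metis of_nat_le_iff of_nat_numeral of_nat_power)
    have "\<bar>f m\<bar> \<le> \<bar>g m\<bar> + \<bar>\<Sum>d\<in>?S. f d\<bar>"
      unfolding moebius_transform.simps[of g m] by (rule abs_triangle_ineq4)
    also have "\<dots> \<le> 1 + (\<Sum>d\<in>?S. \<bar>f d\<bar>)"
      using abs_eq_1[OF Suc.prems(1)] sum_abs[of f ?S] by linarith
    also have "\<dots> \<le> 1 + real (card ?S) * 4 ^ k\<^sup>2"
      by (intro add_left_mono sum_bounded_above fd)
    also have "\<dots> \<le> 1 + 2 ^ Suc k * 4 ^ k\<^sup>2"
      using card by (intro add_left_mono mult_right_mono) auto
    also have "\<dots> \<le> 2 * (2 ^ Suc k * 4 ^ k\<^sup>2)"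
    proof -
      have "(1::real) * 1 \<le> 2 ^ Suc k * 4 ^ k\<^sup>2"
        by (intro mult_mono one_le_power) auto
      then show ?thesis by linarith
    qed
    also have "\<dots> = 2 ^ (2 + k) * 4 ^ k\<^sup>2" by (simp only: power_add power_Suc power2_eq_square mult_ac)
    also have "\<dots> \<le> 2 ^ (2 * (1 + 2 * k)) * 4 ^ k\<^sup>2"
      by (intro mult_right_mono power_increasing) auto
    also have "(2::real) ^ (2 * (1 + 2 * k)) = 4 ^ (1 + 2 * k)"
      by (subst power_mult) simp
    also have "4 ^ (1 + 2 * k) * 4 ^ k\<^sup>2 = (4::real) ^ (1 + 2 * k + k\<^sup>2)"
      by (rule power_add [symmetric])
    also have "1 + 2 * k + k\<^sup>2 = (Suc k)\<^sup>2"
      by (simp add: power2_eq_square)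
    finally show ?thesis .
  qed simp
qed

end

section \<open>The Turan-Kubilius inequality on shifted weights\<close>

text \<open>Equidistribution counts every modulus once, a second moment counts ordered pairs: by
  unique factorisation a product of two distinct primes comes from exactly two of them.\<close>

lemma sum_distinct_pairs_prime_mult_le:
  fixes e :: "nat \<Rightarrow> real"
  assumes "finite Q" "\<And>q. q \<in> Q \<Longrightarrow> prime q"
    and "\<And>R. R \<subseteq> {q * q' | q q'. q \<in> Q \<and> q' \<in> Q} \<Longrightarrow> (\<Sum>d\<in>R. \<bar>e d\<bar>) \<le> B"
  shows "(\<Sum>(q, q') \<in> {(q, q') \<in> Q \<times> Q. q \<noteq> q'}. \<bar>e (q * q')\<bar>) \<le> 2 * B"
proof -
  define P where "P = {(q, q') \<in> Q \<times> Q. q < q'}"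
  define P' where "P' = {(q, q') \<in> Q \<times> Q. q' < q}"
  have fin: "finite P" "finite P'"
    using assms(1) by (auto simp: P_def P'_def intro: finite_subset[of _ "Q \<times> Q"])
  have eq: "{(q, q') \<in> Q \<times> Q. q \<noteq> q'} = P \<union> P'" and dis: "P \<inter> P' = {}"
    by (auto simp: P_def P'_def)
  have inj: "inj_on (\<lambda>(q, q'). q * q') P"
  proof (rule inj_onI, clarify)
    fix a b c d assume *: "(a, b) \<in> P" "(c, d) \<in> P" "a * b = c * d"
    then have p: "prime a" "prime b" "prime c" "prime d" "a < b" "c < d" using assms(2) by (auto simp: P_def)
    have "a dvd c * d" using *(3) by (metis dvd_triv_left)
    then have "a = c \<or> a = d" using p by (metis prime_dvd_mult_iff primes_dvd_imp_eq)
    moreover have "b dvd c * d" using *(3) by (metis dvd_triv_right)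
    then have "b = c \<or> b = d" using p by (metis prime_dvd_mult_iff primes_dvd_imp_eq)
    ultimately show "a = c \<and> b = d" using p by auto
  qed
  have "(\<Sum>(q, q') \<in> P. \<bar>e (q * q')\<bar>) = (\<Sum>d\<in>(\<lambda>(q, q'). q * q') ` P. \<bar>e d\<bar>)"
    by (subst sum.reindex[OF inj]) (auto intro: sum.cong)
  also have "\<dots> \<le> B" by (rule assms(3)) (auto simp: P_def)
  finally have 1: "(\<Sum>(q, q') \<in> P. \<bar>e (q * q')\<bar>) \<le> B" .
  have "(\<Sum>(q, q') \<in> P'. \<bar>e (q * q')\<bar>) = (\<Sum>(q, q') \<in> P. \<bar>e (q * q')\<bar>)"
    by (rule sum.reindex_bij_witness[of _ prod.swap prod.swap]) (auto simp: P_def P'_def mult.commute)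
  with 1 show ?thesis unfolding eq by (subst sum.union_disjoint[OF fin dis]) simp
qed

text \<open>Serves two weights: Lambda with density 1 / totient d, and the constant 1 with density 1
  / d. Through \<open>rho_ge\<close>, lower bounds for sums of prime reciprocals pass to the
  density.\<close>

locale shifted_weight =
  fixes w \<rho> :: "nat \<Rightarrow> real" and N h :: nat and \<theta> B :: real
  assumes w_nonneg: "w n \<ge> 0"
    and rho_1: "\<rho> 1 = 1"
    and rho_mult: "coprime a b \<Longrightarrow> \<rho> (a * b) = \<rho> a * \<rho> b"
    and rho_ge: "d > 0 \<Longrightarrow> \<rho> d \<ge> 1 / real d"
    and N_ge: "N \<ge> 2" and theta: "0 < \<theta>" "\<theta> < 1"
    and equidistribution: "\<And>R. R \<subseteq> {d. 1 \<le> d \<and> real d < real N powr \<theta> \<and> coprime d h} \<Longrightarrow>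
           (\<Sum>d\<in>R. \<bar>(\<Sum>n\<in>{n\<in>{1..N}. d dvd n + h}. w n) - real N * \<rho> d\<bar>) \<le> B"
begin

definition W :: "nat \<Rightarrow> real" where "W d = (\<Sum>n\<in>{n\<in>{1..N}. d dvd n + h}. w n)"

lemma equidistributionW:
  "R \<subseteq> {d. 1 \<le> d \<and> real d < real N powr \<theta> \<and> coprime d h} \<Longrightarrow> (\<Sum>d\<in>R. \<bar>W d - real N * \<rho> d\<bar>) \<le> B"
  using equidistribution by (simp add: W_def)

lemma B_nonneg: "0 \<le> B"
  using equidistribution[of "{}"] by simp

text \<open>Second moment method: with omega n the number of q in Q dividing n + h, the sum of w
  (omega - L)^2 has main term at most N (L^2 + L - 2 L^2 + L^2) = N L, while an n without such q
  contributes w n L^2. The errors add up to B (L^2 + 2 L + 3).\<close>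

lemma turan_kubilius:
  assumes "finite Q" "\<And>q. q \<in> Q \<Longrightarrow> prime q" "\<And>q. q \<in> Q \<Longrightarrow> coprime q h"
    and "\<And>q q'. q \<in> Q \<Longrightarrow> q' \<in> Q \<Longrightarrow> real (q * q') < real N powr \<theta>"
  defines "L \<equiv> (\<Sum>q\<in>Q. \<rho> q)"
  shows "L\<^sup>2 * (\<Sum>n\<in>{n\<in>{1..N}. \<forall>q\<in>Q. \<not> q dvd n + h}. w n) \<le> real N * L + B * (L + 2)\<^sup>2"
proof -
  define c where "c = (\<lambda>q n. of_bool (q dvd n + h) :: real)"
  define \<omega> where "\<omega> = (\<lambda>n. \<Sum>q\<in>Q. c q n)"
  define e where "e = (\<lambda>d. W d - real N * \<rho> d)"
  define P where "P = {(q, q') \<in> Q \<times> Q. q \<noteq> q'}"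
  have W_c: "W q = (\<Sum>n=1..N. w n * c q n)" for q
    unfolding W_def c_def by (simp, intro sum.cong) auto
  have rho0: "\<rho> q \<ge> 0" if "q \<in> Q" for q
    using rho_ge[of q] assms(2)[OF that] by (meson divide_nonneg_nonneg of_nat_0_le_iff order_trans prime_gt_0_nat zero_le_one)
  have L0: "L \<ge> 0" unfolding L_def by (rule sum_nonneg) (rule rho0)
  have finP: "finite P" using assms(1) by (auto simp: P_def intro: finite_subset[of _ "Q \<times> Q"])
  have QQ: "Q \<times> Q = P \<union> (\<lambda>q. (q, q)) ` Q" "P \<inter> (\<lambda>q. (q, q)) ` Q = {}" by (auto simp: P_def)
  have pair: "c q n * c q' n = c (q * q') n" if "(q, q') \<in> P" for q q' n
  proof -
    have "coprime q q'" using that assms(2) by (auto simp: P_def intro: primes_coprime)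
    then show ?thesis unfolding c_def by (auto simp: divides_mult dest: dvd_mult_left dvd_mult_right)
  qed
  have idem: "c q n * c q n = c q n" for q n by (simp add: c_def)
  have om2: "(\<omega> n)\<^sup>2 = (\<Sum>(q, q')\<in>P. c (q * q') n) + \<omega> n" for n
  proof -
    have "(\<omega> n)\<^sup>2 = (\<Sum>(q, q')\<in>Q \<times> Q. c q n * c q' n)"
      unfolding \<omega>_def power2_eq_square by (simp add: sum_product sum.cartesian_product)
    also have "\<dots> = (\<Sum>(q, q')\<in>P. c q n * c q' n) + (\<Sum>(q, q')\<in>(\<lambda>q. (q, q)) ` Q. c q n * c q' n)"
      unfolding QQ(1) by (intro sum.union_disjoint finP QQ(2)) (simp add: assms(1))
    also have "(\<Sum>(q, q')\<in>(\<lambda>q. (q, q)) ` Q. c q n * c q' n) = \<omega> n"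
      unfolding \<omega>_def by (subst sum.reindex) (simp_all add: inj_on_def idem)
    also have "(\<Sum>(q, q')\<in>P. c q n * c q' n) = (\<Sum>(q, q')\<in>P. c (q * q') n)"
      by (intro sum.cong) (auto simp: pair)
    finally show ?thesis .
  qed
  have s1: "(\<Sum>n=1..N. w n * \<omega> n) = (\<Sum>q\<in>Q. W q)"
    unfolding \<omega>_def W_c sum_distrib_left by (rule sum.swap)
  have s2: "(\<Sum>n=1..N. w n * (\<Sum>(q, q')\<in>P. c (q * q') n)) = (\<Sum>(q, q')\<in>P. W (q * q'))"
    unfolding W_c sum_distrib_left case_prod_unfold by (rule sum.swap)
  have s0: "(\<Sum>n=1..N. w n) = W 1" by (simp add: W_c c_def)
  have eP: "(\<Sum>(q, q')\<in>P. \<bar>e (q * q')\<bar>) \<le> 2 * B"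
    unfolding P_def
  proof (rule sum_distinct_pairs_prime_mult_le[OF assms(1,2)])
    fix R assume R: "R \<subseteq> {q * q' | q q'. q \<in> Q \<and> q' \<in> Q}"
    show "(\<Sum>d\<in>R. \<bar>e d\<bar>) \<le> B"
      unfolding e_def
    proof (rule equidistributionW, rule subsetI)
      fix d assume "d \<in> R"
      then obtain q q' where d: "d = q * q'" "q \<in> Q" "q' \<in> Q" using R by blast
      then have "q > 0" "q' > 0" using assms(2) prime_gt_0_nat by blast+
      then have "1 \<le> d" using d by simp
      moreover have "real d < real N powr \<theta>" using assms(4) d by blast
      moreover have "coprime d h" using assms(3) d by simp
      ultimately show "d \<in> {d. 1 \<le> d \<and> real d < real N powr \<theta> \<and> coprime d h}" by blast
    qed
  qed auto
  have eQ: "(\<Sum>q\<in>Q. \<bar>e q\<bar>) \<le> B"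
    unfolding e_def
  proof (rule equidistributionW, safe)
    fix q assume q: "q \<in> Q"
    then have "q > 0" using assms(2) prime_gt_0_nat by blast
    then show "1 \<le> q" by simp
    have "real q \<le> real (q * q)" using \<open>q > 0\<close> by simp
    also have "\<dots> < real N powr \<theta>" by (rule assms(4)[OF q q])
    finally show "real q < real N powr \<theta>" .
    show "coprime q h" by (rule assms(3)[OF q])
  qed
  have "1 < real N powr \<theta>" using N_ge theta by (intro gr_one_powr) auto
  then have e1: "\<bar>e 1\<bar> \<le> B"
    using equidistributionW[of "{1}"] by (simp add: e_def)
  have "L\<^sup>2 * (\<Sum>n\<in>{n\<in>{1..N}. \<forall>q\<in>Q. \<not> q dvd n + h}. w n)
      = (\<Sum>n\<in>{n\<in>{1..N}. \<forall>q\<in>Q. \<not> q dvd n + h}. w n * (\<omega> n - L)\<^sup>2)"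
    unfolding sum_distrib_left by (intro sum.cong) (auto simp: \<omega>_def c_def)
  also have "\<dots> \<le> (\<Sum>n=1..N. w n * (\<omega> n - L)\<^sup>2)"
    by (intro sum_mono2) (auto simp: w_nonneg)
  \<comment> \<open>By \<open>om2\<close> the square consists of the distinct pairs and a diagonal
    omega; the latter turns the coefficient -2 L into 1 - 2 L.\<close>
  also have "\<dots> = (\<Sum>n=1..N. w n * (\<Sum>(q, q')\<in>P. c (q * q') n) + (1 - 2 * L) * (w n * \<omega> n) + L\<^sup>2 * w n)"
    by (intro sum.cong refl) (simp add: power2_diff om2 algebra_simps)
  also have "\<dots> = (\<Sum>(q, q')\<in>P. W (q * q')) + (1 - 2 * L) * (\<Sum>q\<in>Q. W q) + L\<^sup>2 * W 1"
    unfolding sum.distrib s2 sum_distrib_left[symmetric] s1 s0 ..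
  also have "(\<Sum>(q, q')\<in>P. W (q * q')) = (\<Sum>(q, q')\<in>P. real N * (\<rho> q * \<rho> q') + e (q * q'))"
  proof (intro sum.cong refl, clarify)
    fix q q' assume "(q, q') \<in> P"
    then have "coprime q q'" using assms(2) by (auto simp: P_def intro: primes_coprime)
    then show "W (q * q') = real N * (\<rho> q * \<rho> q') + e (q * q')" by (simp add: e_def rho_mult)
  qed
  also have "\<dots> = real N * (\<Sum>(q, q')\<in>P. \<rho> q * \<rho> q') + (\<Sum>(q, q')\<in>P. e (q * q'))"
    by (simp add: case_prod_unfold sum.distrib sum_distrib_left)
  also have "(\<Sum>q\<in>Q. W q) = real N * L + (\<Sum>q\<in>Q. e q)"
    by (simp add: e_def L_def sum_subtractf sum_distrib_left)
  also have "W 1 = real N + e 1" using rho_1 by (simp add: e_def)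
  also have "real N * (\<Sum>(q, q')\<in>P. \<rho> q * \<rho> q') + (\<Sum>(q, q')\<in>P. e (q * q')) +
       (1 - 2 * L) * (real N * L + (\<Sum>q\<in>Q. e q)) + L\<^sup>2 * (real N + e 1)
     \<le> real N * L\<^sup>2 + 2 * B + ((1 - 2 * L) * (real N * L) + (1 + 2 * L) * B) + (L\<^sup>2 * real N + L\<^sup>2 * B)"
  proof -
    have "(\<Sum>(q, q')\<in>P. \<rho> q * \<rho> q') \<le> (\<Sum>(q, q')\<in>Q \<times> Q. \<rho> q * \<rho> q')"
      using assms(1) rho0 by (intro sum_mono2) (auto simp: P_def)
    also have "\<dots> = L\<^sup>2" unfolding L_def power2_eq_square by (simp add: sum_product sum.cartesian_product)
    finally have 1: "real N * (\<Sum>(q, q')\<in>P. \<rho> q * \<rho> q') \<le> real N * L\<^sup>2" by (simp add: mult_left_mono)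
    have 2: "(\<Sum>(q, q')\<in>P. e (q * q')) \<le> 2 * B"
      using eP by (rule order_trans[rotated]) (auto intro: sum_mono)
    have "(1 - 2 * L) * (\<Sum>q\<in>Q. e q) \<le> \<bar>1 - 2 * L\<bar> * \<bar>\<Sum>q\<in>Q. e q\<bar>"
      by (metis abs_ge_self abs_mult)
    also have "\<dots> \<le> (1 + 2 * L) * B"
      using L0 order_trans[OF sum_abs eQ] by (intro mult_mono) auto
    finally have 3: "(1 - 2 * L) * (\<Sum>q\<in>Q. e q) \<le> (1 + 2 * L) * B" .
    have 4: "L\<^sup>2 * e 1 \<le> L\<^sup>2 * B" using e1 by (intro mult_left_mono) auto
    show ?thesis using 1 2 3 4 by (simp add: distrib_left)
  qed
  also have "\<dots> = real N * L + B * (L\<^sup>2 + 2 * L + 3)"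
    by (simp add: algebra_simps power2_eq_square)
  also have "\<dots> \<le> real N * L + B * (L + 2)\<^sup>2"
    using L0 B_nonneg by (intro add_left_mono mult_left_mono) (auto simp: power2_eq_square algebra_simps)
  finally show ?thesis .
qed

end

text \<open>The primes of Q lie below y, so that f vanishes on their multiples; above 2 N^(1 -
  theta), so that none fits into the cofactor of a divisor d >= N^theta; and their products stay
  below N^theta, within reach of equidistribution. \<open>g h = 1\<close> removes the multiples of h
  from the support of f, which keeps the class of -h primitive. The exponent k bounds the number of
  large prime factors of n + h.\<close>

locale shifted_sign_sum = shifted_weight w \<rho> N h \<theta> B + sign_function g
  for w \<rho> :: "nat \<Rightarrow> real" and N h :: nat and \<theta> B :: real and g +
  fixes y :: real and k :: nat and Q :: "nat set" and M :: real
  assumes y: "y > 1" "\<And>q. prime q \<Longrightarrow> real q < y \<Longrightarrow> g q = 1"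
    and h: "prime h" "g h = 1" "h \<le> N" and k: "2 * real N < y ^ Suc k"
    and Q: "finite Q" "\<And>q. q \<in> Q \<Longrightarrow> prime q" "\<And>q. q \<in> Q \<Longrightarrow> coprime q h"
       "\<And>q q'. q \<in> Q \<Longrightarrow> q' \<in> Q \<Longrightarrow> real (q * q') < real N powr \<theta>"
       "\<And>q. q \<in> Q \<Longrightarrow> real q < y" "\<And>q. q \<in> Q \<Longrightarrow> 2 * real N powr (1 - \<theta>) < real q"
    and M: "M \<ge> 1" "(\<Sum>q\<in>Q. 1 / real q) \<ge> M"
begin

definition D :: "nat set" where
  "D = {d. 1 \<le> d \<and> real d < real N powr \<theta> \<and> f d \<noteq> 0}"

lemma D_bounds:
  assumes "d \<in> D" shows "d > 0" "d \<le> N" "coprime d h" "rough y d" "\<bar>f d\<bar> \<le> 4 ^ k\<^sup>2"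
proof -
  show d0: "d > 0" using assms by (auto simp: D_def)
  have "real d < real N powr \<theta>" using assms by (auto simp: D_def)
  also have "\<dots> \<le> real N powr 1" using N_ge theta by (intro powr_mono) auto
  finally show dN: "d \<le> N" using N_ge by simp
  have "\<not> h dvd d" using moebius_transform_eq_0[of h d] assms h d0 by (auto simp: D_def)
  then show "coprime d h" using prime_imp_coprime[OF h(1)] by (simp add: coprime_commute)
  show "rough y d" using moebius_transform_rough[OF y(2) d0] assms by (simp add: D_def)
  have "real d < y ^ Suc k" using k dN N_ge by linarith
  then show "\<bar>f d\<bar> \<le> 4 ^ k\<^sup>2" using abs_moebius_transform_le[OF y d0] by blast
qed

lemma finite_D: "finite D"
  using D_bounds(2) by (intro finite_subset[of D "{..N}"]) auto

text \<open>Suppose n + h = d e with d >= N^theta and f d nonzero. Then q does not divide d, so it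
  divides e, and d e > 2 N >= n + h, which is absurd.\<close>

lemma truncation_exact:
  assumes n: "n \<in> {1..N}" and q: "q \<in> Q" "q dvd n + h"
  shows "(\<Sum>d\<in>{d\<in>D. d dvd n + h}. f d) = g (n + h)"
proof -
  have "g (n + h) = (\<Sum>d | d dvd n + h. f d)" using n by (simp add: sum_moebius_transform)
  also have "\<dots> = (\<Sum>d\<in>{d\<in>D. d dvd n + h}. f d)"
  proof (rule sum.mono_neutral_right)
    show "\<forall>d\<in>{d. d dvd n + h} - {d \<in> D. d dvd n + h}. f d = 0"
    proof (rule ballI, rule ccontr)
      fix d assume d: "d \<in> {d. d dvd n + h} - {d \<in> D. d dvd n + h}" and nz: "f d \<noteq> 0"
      then obtain e where e: "n + h = d * e" by auto
      have de0: "d > 0" "e > 0" using e n by (auto intro!: Nat.gr0I)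
      have big: "real N powr \<theta> \<le> real d" using d nz de0 by (auto simp: D_def)
      have "\<not> q dvd d" using moebius_transform_eq_0[of q d] Q q y nz de0 by blast
      then have "q dvd e" using q e Q(2) by (simp add: prime_dvd_mult_iff)
      then have "q \<le> e" using de0 by (auto intro: dvd_imp_le)
      then have "2 * real N powr (1 - \<theta>) < real e" using Q(6)[OF q(1)] by linarith
      with big have "real N powr \<theta> * (2 * real N powr (1 - \<theta>)) < real d * real e"
        using de0 N_ge by (intro mult_le_less_imp_less) auto
      also have "real d * real e = real (n + h)" by (simp only: e of_nat_mult)
      also have "\<dots> \<le> 2 * real N" using n h by simp
      finally show False using N_ge by (simp add: powr_add[symmetric] mult.left_commute)
    qed
  qed (use n in auto)
  finally show ?thesis by simp
qed

text \<open>Trivial bound for the exceptional n: at most 2^k rough divisors with |f| <= 4^(k^2)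
  each, and the factor 2 absorbs |g| = 1.\<close>

lemma truncation_error:
  assumes n: "n \<in> {1..N}"
  shows "\<bar>g (n + h) - (\<Sum>d\<in>{d\<in>D. d dvd n + h}. f d)\<bar> \<le> 2 * 2 ^ k * 4 ^ k\<^sup>2"
proof -
  have lt: "real (n + h) < y ^ Suc k" using n h k by (intro le_less_trans[OF _ k]) simp
  have "\<bar>\<Sum>d\<in>{d\<in>D. d dvd n + h}. f d\<bar> \<le> (\<Sum>d\<in>{d\<in>D. d dvd n + h}. \<bar>f d\<bar>)" by (rule sum_abs)
  also have "\<dots> \<le> real (card {d\<in>D. d dvd n + h}) * 4 ^ k\<^sup>2"
    by (rule sum_bounded_above) (auto simp: D_bounds)
  also have "\<dots> \<le> 2 ^ k * 4 ^ k\<^sup>2"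
  proof (rule mult_right_mono)
    have "card {d\<in>D. d dvd n + h} \<le> card {d. d dvd n + h \<and> rough y d}"
      using n by (intro card_mono) (auto simp: D_bounds)
    also have "\<dots> \<le> 2 ^ k" using n lt by (intro card_rough_divisors_le y) auto
    finally show "real (card {d\<in>D. d dvd n + h}) \<le> 2 ^ k"
      by (metis of_nat_le_iff of_nat_numeral of_nat_power)
  qed simp
  finally have "\<bar>\<Sum>d\<in>{d\<in>D. d dvd n + h}. f d\<bar> \<le> 2 ^ k * 4 ^ k\<^sup>2" .
  moreover have "(1::real) * 1 \<le> 2 ^ k * 4 ^ k\<^sup>2" by (intro mult_mono one_le_power) auto
  moreover have "\<bar>g (n + h)\<bar> = 1" using n by (intro abs_eq_1) auto
  ultimately show ?thesis by linarith
qed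

text \<open>Exchanging the sums replaces the truncated divisor sum by its main term at the cost
  4^(k^2) B. Truncation matters only for n + h without a prime factor in Q, whose total weight is at
  most N / M + 9 B by \<open>turan_kubilius\<close>.\<close>

lemma sign_sum_approx:
  "\<bar>(\<Sum>n=1..N. w n * g (n + h)) - real N * (\<Sum>d\<in>D. f d * \<rho> d)\<bar> \<le> 2 * 2 ^ k * 4 ^ k\<^sup>2 * (real N / M + 10 * B)"
proof -
  define V where "V = (\<Sum>n\<in>{n\<in>{1..N}. \<forall>q\<in>Q. \<not> q dvd n + h}. w n)"
  define L where "L = (\<Sum>q\<in>Q. \<rho> q)"
  define G where "G = (\<lambda>n. \<Sum>d\<in>{d\<in>D. d dvd n + h}. f d)"
  define K :: real where "K = 2 * 2 ^ k * 4 ^ k\<^sup>2"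
  have "(\<Sum>n=1..N. w n * G n) = (\<Sum>n=1..N. \<Sum>d\<in>D. if d dvd n + h then f d * w n else 0)"
    unfolding G_def by (intro sum.cong refl)
      (simp add: sum.inter_filter[OF finite_D, symmetric] sum_distrib_left mult.commute)
  also have "\<dots> = (\<Sum>d\<in>D. \<Sum>n=1..N. if d dvd n + h then f d * w n else 0)"
    by (rule sum.swap)
  also have "\<dots> = (\<Sum>d\<in>D. f d * W d)"
    unfolding W_def sum_distrib_left by (rule sum.cong[OF refl]) (rule sum.inter_filter[symmetric], simp)
  finally have wG: "(\<Sum>n=1..N. w n * G n) = (\<Sum>d\<in>D. f d * W d)" .
  have "\<bar>(\<Sum>n=1..N. w n * G n) - real N * (\<Sum>d\<in>D. f d * \<rho> d)\<bar> = \<bar>\<Sum>d\<in>D. f d * (W d - real N * \<rho> d)\<bar>"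
    unfolding wG by (simp add: algebra_simps sum_subtractf sum_distrib_left)
  also have "\<dots> \<le> (\<Sum>d\<in>D. 4 ^ k\<^sup>2 * \<bar>W d - real N * \<rho> d\<bar>)"
    by (rule order_trans[OF sum_abs]) (auto intro!: sum_mono mult_right_mono simp: abs_mult D_bounds)
  also have "\<dots> \<le> 4 ^ k\<^sup>2 * B"
    unfolding sum_distrib_left[symmetric] using D_bounds
    by (intro mult_left_mono equidistributionW) (auto simp: D_def)
  finally have 1: "\<bar>(\<Sum>n=1..N. w n * G n) - real N * (\<Sum>d\<in>D. f d * \<rho> d)\<bar> \<le> 4 ^ k\<^sup>2 * B" .
  have "\<bar>(\<Sum>n=1..N. w n * g (n + h)) - (\<Sum>n=1..N. w n * G n)\<bar> \<le> (\<Sum>n=1..N. w n * \<bar>g (n + h) - G n\<bar>)"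
    unfolding sum_subtractf[symmetric] right_diff_distrib[symmetric]
    by (rule order_trans[OF sum_abs]) (simp add: abs_mult w_nonneg)
  also have "\<dots> \<le> (\<Sum>n=1..N. if \<forall>q\<in>Q. \<not> q dvd n + h then K * w n else 0)"
  proof (rule sum_mono)
    fix n assume n: "n \<in> {1..N}"
    show "w n * \<bar>g (n + h) - G n\<bar> \<le> (if \<forall>q\<in>Q. \<not> q dvd n + h then K * w n else 0)"
    proof (cases "\<forall>q\<in>Q. \<not> q dvd n + h")
      case True
      then show ?thesis using mult_left_mono[OF truncation_error[OF n] w_nonneg[of n]]
        by (simp add: K_def G_def mult.commute)
    next
      case False
      then show ?thesis using truncation_exact[OF n] by (auto simp: G_def)
    qed
  qed
  also have "\<dots> = K * V"
    unfolding V_def sum_distrib_left by (simp add: sum.inter_filter[symmetric])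
  finally have 2: "\<bar>(\<Sum>n=1..N. w n * g (n + h)) - (\<Sum>n=1..N. w n * G n)\<bar> \<le> K * V" .
  have M_le: "M \<le> L"
  proof -
    have "(\<Sum>q\<in>Q. 1 / real q) \<le> L"
      unfolding L_def using Q(2) by (intro sum_mono rho_ge) (simp add: prime_gt_0_nat)
    then show ?thesis using M by simp
  qed
  have "L\<^sup>2 * V \<le> real N * L + B * (L + 2)\<^sup>2"
    unfolding L_def V_def by (rule turan_kubilius[OF Q(1-4)])
  \<comment> \<open>L >= M >= 1 gives 1 <= L / M and L + 2 <= 3 L, which brings out the factor L^2
    to be cancelled.\<close>
  also have "\<dots> \<le> real N * L * (L / M) + B * (3 * L)\<^sup>2"
    using M_le M B_nonneg mult_left_mono[of 1 "L / M" "real N * L"]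
    by (intro add_mono mult_left_mono power_mono) (auto simp: field_simps)
  also have "\<dots> = L\<^sup>2 * (real N / M + 9 * B)" by (simp add: power2_eq_square algebra_simps)
  finally have 3: "V \<le> real N / M + 9 * B" using M_le M by simp
  have K: "4 ^ k\<^sup>2 \<le> K"
  proof -
    have "1 \<le> (2::real) ^ k" by (rule one_le_power) simp
    then have "1 \<le> 2 * (2::real) ^ k" by linarith
    then have "1 * 4 ^ k\<^sup>2 \<le> 2 * (2::real) ^ k * 4 ^ k\<^sup>2" by (rule mult_right_mono) simp
    then show ?thesis by (simp add: K_def)
  qed
  have K0: "0 \<le> K" by (simp add: K_def)
  have "\<bar>(\<Sum>n=1..N. w n * g (n + h)) - real N * (\<Sum>d\<in>D. f d * \<rho> d)\<bar> \<le> 4 ^ k\<^sup>2 * B + K * V" using 1 2 by linarith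
  also have "\<dots> \<le> K * B + K * (real N / M + 9 * B)"
    by (intro add_mono mult_right_mono mult_left_mono K 3 K0 B_nonneg)
  also have "\<dots> = K * (real N / M + 10 * B)" by (simp add: algebra_simps)
  finally show ?thesis unfolding K_def .
qed

end

section \<open>Sign functions along shifted primes\<close>

lemma harm_le: "n > 0 \<Longrightarrow> (\<Sum>k=1..n. 1 / real k) \<le> 1 + ln (real n)"
  using euler_mascheroni_upper[of n] euler_mascheroni_sequence_decreasing[of 1 n]
  by (simp add: harm_def inverse_eq_divide)

lemma card_shifted_multiples_approx:
  assumes "d > 0"
  shows "\<bar>real (card {n\<in>{1..N}. d dvd n + h}) - real N / real d\<bar> \<le> 1"
proof -
  have "{n\<in>{1..N + h}. d dvd n} = {n\<in>{1..h}. d dvd n} \<union> (\<lambda>n. n + h) ` {n\<in>{1..N}. d dvd n + h}" (is "_ = ?A \<union> ?B")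
  proof (intro equalityI subsetI)
    fix n assume n: "n \<in> {n\<in>{1..N + h}. d dvd n}"
    show "n \<in> ?A \<union> ?B"
    proof (cases "n \<le> h")
      case False
      then have "n = (n - h) + h" by simp
      moreover have "n - h \<in> {n\<in>{1..N}. d dvd n + h}" using False n by auto
      ultimately show ?thesis by blast
    qed (use n in auto)
  qed auto
  then have "card {n\<in>{1..N + h}. d dvd n} = card (?A \<union> ?B)" by simp
  also have "card (?A \<union> ?B) = card ?A + card ?B"
    by (rule card_Un_disjoint) auto
  also have "card ?B = card {n\<in>{1..N}. d dvd n + h}" by (rule card_image) (auto simp: inj_on_def)
  finally have "(N + h) div d = h div d + card {n\<in>{1..N}. d dvd n + h}"
    using card_multiples[OF assms, of "N + h"] card_multiples[OF assms, of h] by simp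
  then have eq: "real ((N + h) div d) = real (h div d) + real (card {n\<in>{1..N}. d dvd n + h})"
    by (metis of_nat_add)
  have lo: "real m / real d - 1 < real (m div d)" for m
    using real_of_nat_div[of m d] assms by (smt (verit) floor_divide_of_nat_eq floor_less_iff of_int_of_nat_eq real_of_int_floor_gt_diff_one)
  have hi: "real (m div d) \<le> real m / real d" for m by (rule of_nat_div_le_of_nat)
  have "real (N + h) / real d = real N / real d + real h / real d" by (simp add: add_divide_distrib)
  then show ?thesis using eq lo[of "N + h"] lo[of h] hi[of "N + h"] hi[of h] by linarith
qed

text \<open>The prime factors of d are among its rough divisors, so there are at most 2^k of them,
  all >= y; the Weierstrass inequality gives totient d / d >= 1 - 2^k / y. This is what matches the
  main terms of the two weights.\<close>

lemma rough_totient_approx: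
  assumes "rough y d" "d > 0" "y > 1" "real d < y ^ Suc k" "2 * 2 ^ k \<le> y"
  shows "\<bar>1 / real (totient d) - 1 / real d\<bar> \<le> 2 * 2 ^ k / y * (1 / real d)"
proof -
  let ?\<delta> = "2 ^ k / y"
  have \<delta>: "0 \<le> ?\<delta>" "?\<delta> \<le> 1 / 2" using assms by (auto simp: field_simps)
  then have \<delta>1: "?\<delta> < 1" by linarith
  have "prime_factors d \<subseteq> {e. e dvd d \<and> rough y e}"
    using assms(1) rough_dvd by (auto simp: in_prime_factors_iff)
  then have "card (prime_factors d) \<le> card {e. e dvd d \<and> rough y e}"
    using assms(2) by (intro card_mono) auto
  also have "\<dots> \<le> 2 ^ k" using assms by (intro card_rough_divisors_le) auto
  finally have card: "real (card (prime_factors d)) \<le> 2 ^ k"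
    by (metis of_nat_le_iff of_nat_numeral of_nat_power)
  have "(\<Sum>q\<in>prime_factors d. 1 / real q) \<le> (\<Sum>q\<in>prime_factors d. 1 / y)"
  proof (rule sum_mono)
    fix q assume "q \<in> prime_factors d"
    then have "y \<le> real q" using assms(1) by (auto simp: in_prime_factors_iff intro: roughD)
    then show "1 / real q \<le> 1 / y" using assms(3) by (intro divide_left_mono) auto
  qed
  also have "\<dots> \<le> ?\<delta>" using card assms(3) by (simp add: divide_right_mono)
  finally have "1 - ?\<delta> \<le> 1 - (\<Sum>q\<in>prime_factors d. 1 / real q)" by simp
  also have "\<dots> \<le> (\<Prod>q\<in>prime_factors d. 1 - 1 / real q)"
    by (rule Weierstrass_prod_ineq) (auto simp: in_prime_factors_iff prime_gt_0_nat Suc_le_eq field_simps)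
  finally have "real d * (1 - ?\<delta>) \<le> real (totient d)"
    unfolding totient_formula2 by (intro mult_left_mono) auto
  then have "1 / real (totient d) \<le> 1 / (real d * (1 - ?\<delta>))"
    using assms(2) \<delta>1 by (intro divide_left_mono mult_pos_pos) auto
  also have "\<dots> \<le> (1 + 2 * ?\<delta>) / real d"
  proof -
    have "1 \<le> (1 + 2 * \<eta>) * (1 - \<eta>)" if "0 \<le> \<eta>" "\<eta> \<le> 1 / 2" for \<eta> :: real
    proof -
      have "0 \<le> \<eta> * (1 - 2 * \<eta>)" using that by (intro mult_nonneg_nonneg) auto
      then show ?thesis by (simp add: algebra_simps)
    qed
    from this[OF \<delta>] have "1 / (1 - ?\<delta>) \<le> 1 + 2 * ?\<delta>" using \<delta>1 by (subst pos_divide_le_eq) auto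
    then have "1 / (1 - ?\<delta>) / real d \<le> (1 + 2 * ?\<delta>) / real d" by (rule divide_right_mono) simp
    then show ?thesis by (simp only: divide_divide_eq_left mult.commute)
  qed
  finally have "1 / real (totient d) - 1 / real d \<le> 2 * ?\<delta> * (1 / real d)" by (simp add: add_divide_distrib)
  moreover have "1 / real d \<le> 1 / real (totient d)"
    using assms(2) totient_le[of d] by (intro divide_left_mono) auto
  ultimately show ?thesis by simp
qed

text \<open>\<open>sign_sum_approx\<close> applies to both weights with the same divisor set, and f
  lives on rough d, where the two densities almost agree. The constants are chosen in the order k,
  M, a, theta: M makes the exceptional n negligible against kappa, a depends on M, and theta on
  a.\<close>

lemma sum_mangoldt_sign_function_approx:
  assumes "elliott_halberstam" "0 < b" "b \<le> 1 / 4" "\<kappa> > 0"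
  obtains N0 where "\<And>N h g. N \<ge> N0 \<Longrightarrow> sign_function g \<Longrightarrow> prime h \<Longrightarrow> g h = 1 \<Longrightarrow> h \<le> N \<Longrightarrow>
      real N powr b \<le> real h \<Longrightarrow> (\<And>q. prime q \<Longrightarrow> real q < real N powr b \<Longrightarrow> g q = 1) \<Longrightarrow>
      \<bar>(\<Sum>n=1..N. mangoldt n * g (n + h)) - (\<Sum>n=1..N. g (n + h))\<bar> \<le> \<kappa> * real N"
proof -
  obtain C0 where C0: "\<And>N. (\<Sum>n=1..N. mangoldt n) \<le> C0 * real N"
    using chebyshev_upper[OF assms(1)] by blast
  \<comment> \<open>With y = x^b this gives y^(k+1) >= x^2 > 2 x.\<close>
  define k where "k = nat \<lceil>2 / b\<rceil>"
  define K :: real where "K = 2 * 2 ^ k * 4 ^ k\<^sup>2"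
  define M where "M = max 1 (8 * K / \<kappa>)"
  have K: "K > 0" by (simp add: K_def)
  have M: "M \<ge> 1" by (simp add: M_def)
  have KM: "K / M \<le> \<kappa> / 8"
  proof -
    have "8 * K / \<kappa> \<le> M" by (simp add: M_def)
    then show ?thesis using assms(4) M by (simp add: field_simps)
  qed
  have bk: "b * real (Suc k) \<ge> 2 + b"
  proof -
    have "2 / b \<le> real k" unfolding k_def by (rule real_nat_ceiling_ge)
    then show ?thesis using assms(2) by (simp add: field_simps)
  qed
  \<comment> \<open>The upper end b / 2 keeps products of two such primes at most x^b, hence below
    x^theta.\<close>
  obtain a where a: "0 < a" "a < b / 2" and evQ:
     "eventually (\<lambda>x::real. (\<Sum>q\<in>{q. prime q \<and> x powr a < real q \<and> real q \<le> x powr (b / 2)}. 1 / real q) \<ge> M) at_top"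
    using prime_reciprocal_sum_large[OF C0, of "b / 2" M] assms(2) by auto
  \<comment> \<open>Then 2 x^(1 - theta) = 2 x^(a/2) is at most x^a as soon as x^(a/2) >= 2.\<close>
  define \<theta> where "\<theta> = 1 - a / 2"
  have \<theta>: "0 < \<theta>" "\<theta> < 1" "b < \<theta>" using a assms(3) by (auto simp: \<theta>_def)
  obtain C where C: "C \<ge> 0"
    "\<And>N h R. N \<ge> 2 \<Longrightarrow> h > 0 \<Longrightarrow> R \<subseteq> {d. 1 \<le> d \<and> real d < real N powr \<theta> \<and> coprime d h} \<Longrightarrow>
       (\<Sum>d\<in>R. \<bar>(\<Sum>n\<in>{n\<in>{1..N}. d dvd n + h}. mangoldt n) - real N * (1 / real (totient d))\<bar>)
         \<le> C * (real N * ln (real N) powr (-2))"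
    by (rule elliott_halberstam_shifted[OF assms(1) \<theta>(1,2)]) blast
  have small: "eventually (\<lambda>x. c * u x \<le> e) at_top" if "(u \<longlongrightarrow> 0) at_top" "e > 0" for u :: "real \<Rightarrow> real" and c e
  proof -
    have "((\<lambda>x. c * u x) \<longlongrightarrow> 0) at_top" using that(1) by (rule tendsto_mult_right_zero)
    then have "eventually (\<lambda>x. c * u x < e) at_top" using that(2) by (rule order_tendstoD)
    then show ?thesis by eventually_elim simp
  qed
  have "eventually (\<lambda>x::real. (10 * K * C) * (ln x powr (-2)) \<le> \<kappa> / 8) at_top"
    by (rule small) (use assms(4) in real_asymp, use assms(4) in simp)
  moreover have "eventually (\<lambda>x::real. (10 * K) * (x powr (\<theta> - 1)) \<le> \<kappa> / 8) at_top"
    by (rule small) (use \<theta> in real_asymp, use assms(4) in simp)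
  moreover have "eventually (\<lambda>x::real. K * ((1 + ln x) * x powr (- b)) \<le> \<kappa> / 4) at_top"
    by (rule small) (use assms(2) in real_asymp, use assms(4) in simp)
  moreover have "eventually (\<lambda>x::real. 2 \<le> x powr (a / 2)) at_top" using a by real_asymp
  moreover have "eventually (\<lambda>x::real. 2 * 2 ^ k \<le> x powr b) at_top"
  proof -
    have "filterlim (\<lambda>x::real. x powr b) at_top at_top" using assms(2) by real_asymp
    then show ?thesis by (simp add: filterlim_at_top)
  qed
  ultimately have "eventually (\<lambda>x::real. (10 * K * C) * (ln x powr (-2)) \<le> \<kappa> / 8 \<and> (10 * K) * (x powr (\<theta> - 1)) \<le> \<kappa> / 8
     \<and> K * ((1 + ln x) * x powr (- b)) \<le> \<kappa> / 4 \<and> 2 \<le> x powr (a / 2) \<and> 2 * 2 ^ k \<le> x powr b \<and> x \<ge> 3 \<and>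
     (\<Sum>q\<in>{q. prime q \<and> x powr a < real q \<and> real q \<le> x powr (b / 2)}. 1 / real q) \<ge> M) at_top"
    using evQ eventually_ge_at_top[of 3] by (intro eventually_conj)
  then obtain x0 where x0: "\<And>x. x \<ge> x0 \<Longrightarrow> (10 * K * C) * (ln x powr (-2)) \<le> \<kappa> / 8 \<and> (10 * K) * (x powr (\<theta> - 1)) \<le> \<kappa> / 8
     \<and> K * ((1 + ln x) * x powr (- b)) \<le> \<kappa> / 4 \<and> 2 \<le> x powr (a / 2) \<and> 2 * 2 ^ k \<le> x powr b \<and> x \<ge> 3 \<and>
     (\<Sum>q\<in>{q. prime q \<and> x powr a < real q \<and> real q \<le> x powr (b / 2)}. 1 / real q) \<ge> M"
    unfolding eventually_at_top_linorder by blast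
  have main: "\<bar>(\<Sum>n=1..N. mangoldt n * g (n + h)) - (\<Sum>n=1..N. g (n + h))\<bar> \<le> \<kappa> * real N"
    if N: "N \<ge> nat \<lceil>x0\<rceil>" and g: "sign_function g" and h: "prime h" "g h = 1" "h \<le> N" "real N powr b \<le> real h"
      and g1: "\<And>q. prime q \<Longrightarrow> real q < real N powr b \<Longrightarrow> g q = 1" for N h g
  proof -
    define x where "x = real N"
    have "x \<ge> x0" using N real_nat_ceiling_ge[of x0] unfolding x_def by linarith
    note X = x0[OF this]
    then have E: "(10 * K * C) * (ln x powr (-2)) \<le> \<kappa> / 8" "(10 * K) * (x powr (\<theta> - 1)) \<le> \<kappa> / 8"
       "K * ((1 + ln x) * x powr (- b)) \<le> \<kappa> / 4" "2 \<le> x powr (a / 2)" "2 * 2 ^ k \<le> x powr b" "x \<ge> 3"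
       "(\<Sum>q\<in>{q. prime q \<and> x powr a < real q \<and> real q \<le> x powr (b / 2)}. 1 / real q) \<ge> M" by auto
    define y where "y = x powr b"
    define Q where "Q = {q. prime q \<and> x powr a < real q \<and> real q \<le> x powr (b / 2)}"
    have y1: "y > 1" using E(6) assms(2) by (simp add: y_def gr_one_powr)
    have Qy: "real q < y" if "q \<in> Q" for q
    proof -
      have "real q \<le> x powr (b / 2)" using that by (simp add: Q_def)
      also have "\<dots> < y" unfolding y_def using E(6) assms(2) by (intro powr_less_mono) auto
      finally show ?thesis .
    qed
    have yk: "2 * x < y ^ Suc k"
    proof -
      have "2 * x < x * x" using E(6) by simp
      also have "\<dots> = x powr 2" using E(6) by (simp add: powr_numeral power2_eq_square)
      also have "\<dots> \<le> x powr (b * real (Suc k))" using E(6) bk assms(2) by (intro powr_mono) auto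
      also have "\<dots> = y ^ Suc k" unfolding y_def using E(6) powr_realpow[of "x powr b" "Suc k"] by (simp only: powr_powr) simp
      finally show ?thesis .
    qed
    have common: "shifted_sign_sum_axioms N h \<theta> g y k Q M"
    proof
      show "1 < y" by (rule y1)
      show "prime q \<Longrightarrow> real q < y \<Longrightarrow> g q = 1" for q using g1 by (simp add: y_def x_def)
      show "prime h" "g h = 1" "h \<le> N" by (rule h)+
      show "2 * real N < y ^ Suc k" using yk by (simp only: x_def)
      show "finite Q" by (rule finite_subset[of _ "{..nat \<lfloor>x powr (b / 2)\<rfloor>}"]) (auto simp: Q_def le_nat_floor)
      show "prime q" if "q \<in> Q" for q using that by (simp add: Q_def)
      show "coprime q h" if "q \<in> Q" for q
        using Qy[OF that] that h by (intro primes_coprime) (auto simp: Q_def y_def x_def)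
      show "real (q * q') < real N powr \<theta>" if "q \<in> Q" "q' \<in> Q" for q q'
      proof -
        have "real (q * q') \<le> x powr (b / 2) * x powr (b / 2)"
          unfolding of_nat_mult using that by (intro mult_mono) (auto simp: Q_def)
        also have "\<dots> = x powr b" by (simp add: powr_add[symmetric])
        also have "\<dots> < x powr \<theta>" using E(6) \<theta> by (intro powr_less_mono) auto
        finally show ?thesis by (simp add: x_def)
      qed
      show "real q < y" if "q \<in> Q" for q using Qy that .
      show "2 * real N powr (1 - \<theta>) < real q" if "q \<in> Q" for q
      proof -
        have "2 * x powr (1 - \<theta>) \<le> x powr (a / 2) * x powr (a / 2)"
          using E(4) by (intro mult_mono) (auto simp: \<theta>_def)
        also have "\<dots> = x powr a" by (simp add: powr_add[symmetric])
        also have "\<dots> < real q" using that by (simp add: Q_def)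
        finally show ?thesis by (simp add: x_def)
      qed
      show "1 \<le> M" by (rule M)
      show "M \<le> (\<Sum>q\<in>Q. 1 / real q)" using E(7) by (simp add: Q_def)
    qed
    have N2: "N \<ge> 2" and h0: "h > 0" using E(6) h(1) prime_gt_0_nat by (auto simp: x_def)
    interpret P: shifted_sign_sum mangoldt "\<lambda>d. 1 / real (totient d)" N h \<theta> "C * (x * ln x powr (-2))" g y k Q M
    proof (intro shifted_sign_sum.intro common g, unfold_locales)
      show "0 \<le> (mangoldt n :: real)" for n by (rule mangoldt_nonneg)
      show "coprime m n \<Longrightarrow> 1 / real (totient (m * n)) = 1 / real (totient m) * (1 / real (totient n))" for m n
        by (simp add: totient_mult_coprime)
      show "0 < d \<Longrightarrow> 1 / real d \<le> 1 / real (totient d)" for d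
        using totient_le[of d] by (intro divide_left_mono) auto
      show "(\<Sum>d\<in>R. \<bar>sum mangoldt {n \<in> {1..N}. d dvd n + h} - real N * (1 / real (totient d))\<bar>) \<le> C * (x * ln x powr - 2)"
        if "R \<subseteq> {d. 1 \<le> d \<and> real d < real N powr \<theta> \<and> coprime d h}" for R
        unfolding x_def by (rule C(2)[OF N2 h0 that])
    qed (use N2 h0 \<theta> in auto)
    \<comment> \<open>For the weight 1 every modulus has counting error at most 1, and there are at
      most x^theta moduli.\<close>
    interpret U: shifted_sign_sum "\<lambda>_. 1" "\<lambda>d. 1 / real d" N h \<theta> "x powr \<theta>" g y k Q M
    proof (intro shifted_sign_sum.intro common g, unfold_locales)
      show "(\<Sum>d\<in>R. \<bar>(\<Sum>n\<in>{n \<in> {1..N}. d dvd n + h}. 1) - real N * (1 / real d)\<bar>) \<le> x powr \<theta>"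
        if R: "R \<subseteq> {d. 1 \<le> d \<and> real d < real N powr \<theta> \<and> coprime d h}" for R
      proof -
        have sub: "R \<subseteq> {1..nat \<lfloor>x powr \<theta>\<rfloor>}" 
        proof
          fix d assume "d \<in> R"
          then have "1 \<le> d" "real d \<le> x powr \<theta>" using R by (auto simp: x_def)
          then show "d \<in> {1..nat \<lfloor>x powr \<theta>\<rfloor>}" by (simp add: le_nat_floor)
        qed
        have "(\<Sum>d\<in>R. \<bar>(\<Sum>n\<in>{n \<in> {1..N}. d dvd n + h}. 1) - real N * (1 / real d)\<bar>) \<le> (\<Sum>d\<in>R. 1)"
        proof (rule sum_mono)
          fix d assume "d \<in> R"
          then have "d > 0" using sub by auto
          from card_shifted_multiples_approx[OF this, of N h]
          show "\<bar>(\<Sum>n\<in>{n \<in> {1..N}. d dvd n + h}. 1) - real N * (1 / real d)\<bar> \<le> 1" by simp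
        qed
        also have "\<dots> = real (card R)" by simp
        also have "\<dots> \<le> real (card {1..nat \<lfloor>x powr \<theta>\<rfloor>})" using sub by (intro of_nat_mono card_mono) auto
        also have "\<dots> \<le> x powr \<theta>" by (simp add: of_nat_floor)
        finally show ?thesis .
      qed
    qed (use N2 h0 \<theta> in auto)
    \<comment> \<open>The relative error 2 * 2^k / y saves a power of x, which outweighs the
      harmonic sum 1 + ln x.\<close>
    have "\<bar>(\<Sum>d\<in>P.D. P.f d * (1 / real (totient d))) - (\<Sum>d\<in>P.D. P.f d * (1 / real d))\<bar> \<le> \<kappa> / 4"
    proof -
      have "\<bar>(\<Sum>d\<in>P.D. P.f d * (1 / real (totient d))) - (\<Sum>d\<in>P.D. P.f d * (1 / real d))\<bar>
          = \<bar>\<Sum>d\<in>P.D. P.f d * (1 / real (totient d) - 1 / real d)\<bar>"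
        by (simp add: sum_subtractf[symmetric] right_diff_distrib)
      also have "\<dots> \<le> (\<Sum>d\<in>P.D. \<bar>P.f d\<bar> * \<bar>1 / real (totient d) - 1 / real d\<bar>)"
        unfolding abs_mult[symmetric] by (rule sum_abs)
      also have "\<dots> \<le> (\<Sum>d\<in>P.D. 4 ^ k\<^sup>2 * (2 * 2 ^ k / y * (1 / real d)))"
      proof (intro sum_mono mult_mono)
        fix d assume d: "d \<in> P.D"
        note db = P.D_bounds[OF d]
        show "\<bar>P.f d\<bar> \<le> 4 ^ k\<^sup>2" by (rule db)
        have "real d < y ^ Suc k" using db(2) yk E(6) unfolding x_def by linarith
        then show "\<bar>1 / real (totient d) - 1 / real d\<bar> \<le> 2 * 2 ^ k / y * (1 / real d)"
          using E(5) by (intro rough_totient_approx db y1) (auto simp: y_def)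
      qed auto
      also have "\<dots> = K / y * (\<Sum>d\<in>P.D. 1 / real d)"
        unfolding sum_distrib_left by (intro sum.cong refl) (simp add: K_def mult_ac)
      also have "\<dots> \<le> K / y * (\<Sum>d=1..N. 1 / real d)"
        using K y1 P.D_bounds by (intro mult_left_mono sum_mono2) (auto simp: Suc_le_eq)
      also have "\<dots> \<le> K / y * (1 + ln x)"
        using K y1 N2 harm_le[of N] by (intro mult_left_mono) (auto simp: x_def)
      also have "\<dots> = K * ((1 + ln x) * x powr (- b))" by (simp add: y_def powr_minus divide_inverse)
      also have "\<dots> \<le> \<kappa> / 4" by (rule E)
      finally show ?thesis .
    qed
    then have "x * \<bar>(\<Sum>d\<in>P.D. P.f d * (1 / real (totient d))) - (\<Sum>d\<in>P.D. P.f d * (1 / real d))\<bar> \<le> x * (\<kappa> / 4)"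
      using E(6) by (intro mult_left_mono) auto
    moreover have "x * \<bar>(\<Sum>d\<in>P.D. P.f d * (1 / real (totient d))) - (\<Sum>d\<in>P.D. P.f d * (1 / real d))\<bar>
       = \<bar>x * (\<Sum>d\<in>P.D. P.f d * (1 / real (totient d))) - x * (\<Sum>d\<in>P.D. P.f d * (1 / real d))\<bar>"
      using E(6) by (simp add: abs_mult right_diff_distrib[symmetric])
    ultimately have D: "\<bar>x * (\<Sum>d\<in>P.D. P.f d * (1 / real (totient d))) - x * (\<Sum>d\<in>P.D. P.f d * (1 / real d))\<bar> \<le> x * (\<kappa> / 4)"
      by simp
    have xKM: "K * (x / M) \<le> x * (\<kappa> / 8)" using mult_left_mono[OF KM, of x] E(6) by (simp add: mult.commute)
    have B1: "K * (10 * (C * (x * ln x powr (-2)))) \<le> x * (\<kappa> / 8)"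
      using mult_left_mono[OF E(1), of x] E(6) by (simp add: mult_ac)
    have B2: "K * (10 * (x powr \<theta>)) \<le> x * (\<kappa> / 8)"
    proof -
      have "x powr \<theta> = x * x powr (\<theta> - 1)" using E(6) by (simp add: powr_diff)
      then show ?thesis using mult_left_mono[OF E(2), of x] E(6) by (simp add: mult_ac)
    qed
    have 1: "\<bar>(\<Sum>n=1..N. mangoldt n * g (n + h)) - x * (\<Sum>d\<in>P.D. P.f d * (1 / real (totient d)))\<bar> \<le> x * (\<kappa> / 4)"
      using P.sign_sum_approx xKM B1 unfolding K_def[symmetric] x_def[symmetric] distrib_left by linarith
    have 2: "\<bar>(\<Sum>n=1..N. g (n + h)) - x * (\<Sum>d\<in>P.D. P.f d * (1 / real d))\<bar> \<le> x * (\<kappa> / 4)"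
      using U.sign_sum_approx xKM B2 unfolding K_def[symmetric] x_def[symmetric] distrib_left mult_1 by linarith
    have "x * (\<kappa> / 4) + x * (\<kappa> / 4) + x * (\<kappa> / 4) \<le> \<kappa> * x" using E(6) assms(4) by simp
    then show ?thesis using D 1 2 unfolding x_def[symmetric] by linarith
  qed
  show thesis by (rule that[of "nat \<lceil>x0\<rceil>"]) (rule main)
qed

section \<open>The Legendre symbol\<close>

definition legendre :: "nat \<Rightarrow> nat \<Rightarrow> real" where
  "legendre p n = real_of_int (Legendre (int n) (int p))"

lemma legendre_values: "legendre p n \<in> {-1, 0, 1}"
  by (simp add: legendre_def Legendre_def)

lemma abs_legendre_le: "\<bar>legendre p n\<bar> \<le> 1"
  using legendre_values[of p n] by auto

lemma legendre_eq_0_iff: "legendre p n = 0 \<longleftrightarrow> p dvd n"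
  by (auto simp: legendre_def Legendre_def cong_0_iff)

lemma legendre_cong:
  assumes "[m = n] (mod p)" shows "legendre p m = legendre p n"
proof -
  have c: "[int m = int n] (mod int p)" using assms by (simp add: cong_int_iff)
  then have "[int m = 0] (mod int p) \<longleftrightarrow> [int n = 0] (mod int p)"
    by (meson cong_sym cong_trans)
  moreover have "QuadRes (int p) (int m) \<longleftrightarrow> QuadRes (int p) (int n)"
    unfolding QuadRes_def using c by (meson cong_sym cong_trans)
  ultimately show ?thesis by (simp add: legendre_def Legendre_def)
qed

context
  fixes p :: nat
  assumes p: "prime p" "p > 2"
begin

text \<open>Euler's criterion gives the congruence modulo p; both sides lie between -1 and 1, so
  they differ by at most 2 < p.\<close>

lemma legendre_mult: "legendre p (m * n) = legendre p m * legendre p n"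
proof -
  let ?L = "\<lambda>a. Legendre (int a) (int p)" and ?k = "(p - 1) div 2"
  have e: "[?L a = int a ^ ?k] (mod int p)" for a using euler_criterion[OF p] by simp
  have "[?L m * ?L n = int m ^ ?k * int n ^ ?k] (mod int p)" by (intro cong_mult e)
  also have "int m ^ ?k * int n ^ ?k = int (m * n) ^ ?k" by (simp add: power_mult_distrib)
  also have "[int (m * n) ^ ?k = ?L (m * n)] (mod int p)" by (rule cong_sym[OF e])
  finally have dvd: "int p dvd ?L m * ?L n - ?L (m * n)" by (simp add: cong_iff_dvd_diff)
  have "?L m * ?L n - ?L (m * n) = 0"
  proof (rule ccontr)
    assume "?L m * ?L n - ?L (m * n) \<noteq> 0"
    then have "int p \<le> \<bar>?L m * ?L n - ?L (m * n)\<bar>"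
      using dvd by (metis dvd_imp_le_int abs_of_nat)
    moreover have "\<bar>?L m * ?L n - ?L (m * n)\<bar> \<le> 2" by (auto simp: Legendre_def)
    ultimately show False using p by simp
  qed
  then show ?thesis unfolding legendre_def by (metis eq_iff_diff_eq_0 of_int_mult)
qed

lemma legendre_1: "legendre p 1 = 1"
proof -
  have "legendre p 1 * legendre p 1 = legendre p 1" using legendre_mult[of 1 1] by simp
  moreover have "legendre p 1 \<noteq> 0" using p by (simp add: legendre_eq_0_iff)
  ultimately show ?thesis by simp
qed

text \<open>A primitive root has order p - 1, whereas by Euler's criterion the order of a residue
  divides (p - 1) / 2.\<close>

lemma ex_nonresidue: obtains r where "r < p" "\<not> QuadRes (int p) (int r)"
proof -
  have "\<exists>g. residue_primroot p g" using p by (simp add: prime_primitive_root_exists)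
  then obtain g where g: "residue_primroot p g" by blast
  have og: "ord p g = p - 1" using g p by (simp add: residue_primroot_def totient_prime)
  have cop: "coprime p g" using g by (simp add: residue_primroot_def)
  have "\<not> QuadRes (int p) (int g)"
  proof
    assume "QuadRes (int p) (int g)"
    then have "Legendre (int g) (int p) = 1"
      using cop p by (auto simp: Legendre_def cong_0_iff dest: coprime_common_divisor_nat[of p g p])
    then have "[int g ^ ((p - 1) div 2) = 1] (mod int p)"
      using euler_criterion[OF p, of "int g"] by (simp add: cong_sym_eq)
    then have "[g ^ ((p - 1) div 2) = 1] (mod p)"
      by (metis cong_int_iff of_nat_1 of_nat_power)
    then have "p - 1 dvd (p - 1) div 2" using og by (simp add: ord_divides')
    moreover have "0 < (p - 1) div 2" "(p - 1) div 2 < p - 1" using p by auto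
    ultimately show False by (auto dest: dvd_imp_le)
  qed
  moreover have "QuadRes (int p) (int (g mod p)) \<longleftrightarrow> QuadRes (int p) (int g)"
    unfolding QuadRes_def by (simp add: zmod_int cong_def)
  ultimately show thesis using that[of "g mod p"] p by simp
qed

lemma least_nonres_less: "least_nonres p < p"
proof -
  obtain r where "r < p" "\<not> QuadRes (int p) (int r)" by (rule ex_nonresidue)
  then show ?thesis unfolding least_nonres_def by (metis (mono_tags, lifting) Least_le le_less_trans)
qed

lemma legendre_eq_1_below_least_nonres:
  assumes "n > 0" "n < least_nonres p" shows "legendre p n = 1"
proof -
  have "QuadRes (int p) (int n)" using assms(2) not_less_Least unfolding least_nonres_def by blast
  moreover have "\<not> p dvd n" using assms least_nonres_less by (auto dest: dvd_imp_le)
  ultimately show ?thesis by (simp add: legendre_def Legendre_def cong_0_iff)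
qed

text \<open>Multiplication by a nonresidue permutes the residues and flips every sign.\<close>

lemma sum_legendre_period: "(\<Sum>n<p. legendre p n) = 0"
proof -
  obtain r where r: "r < p" "\<not> QuadRes (int p) (int r)" by (rule ex_nonresidue)
  have "\<not> p dvd r"
  proof
    assume "p dvd r"
    then have "r = 0" using r by (auto dest: dvd_imp_le)
    moreover have "QuadRes (int p) 0" unfolding QuadRes_def by (intro exI[of _ 0]) simp
    ultimately show False using r by simp
  qed
  then have Lr: "legendre p r = -1" and cop: "coprime r p" using r p
    by (auto simp: legendre_def Legendre_def cong_0_iff coprime_commute intro: prime_imp_coprime)
  have inj: "inj_on (\<lambda>n. r * n mod p) {..<p}"
  proof (rule inj_onI)
    fix a b assume "a \<in> {..<p}" "b \<in> {..<p}" "r * a mod p = r * b mod p"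
    then show "a = b" using cop cong_mult_lcancel_nat[of r p a b]
      by (metis cong_def lessThan_iff mod_less)
  qed
  have "(\<lambda>n. r * n mod p) ` {..<p} = {..<p}"
    using p inj by (intro card_subset_eq) (auto simp: card_image)
  then have "(\<Sum>n<p. legendre p n) = (\<Sum>n\<in>(\<lambda>n. r * n mod p) ` {..<p}. legendre p n)" by simp
  also have "\<dots> = (\<Sum>n<p. legendre p (r * n mod p))" by (simp add: sum.reindex[OF inj])
  also have "\<dots> = (\<Sum>n<p. legendre p r * legendre p n)"
    unfolding legendre_mult[symmetric] by (intro sum.cong refl legendre_cong) (simp add: cong_def)
  also have "\<dots> = - (\<Sum>n<p. legendre p n)" by (simp add: Lr sum_negf)
  finally show ?thesis by simp
qed

lemma abs_sum_legendre_le: "\<bar>\<Sum>n=1..N. legendre p n\<bar> \<le> real p"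
proof -
  have split: "(\<Sum>n<a + m. u n) = (\<Sum>n<a. u n) + (\<Sum>n<m. u (a + n))" for a m and u :: "nat \<Rightarrow> real"
    by (induction m) auto
  have "(\<Sum>n<j * p + i. legendre p n) = (\<Sum>n<i. legendre p n)" for j i
  proof (induction j)
    case (Suc j)
    have "(\<Sum>n<Suc j * p + i. legendre p n) = (\<Sum>n<p + (j * p + i). legendre p n)" by (simp add: algebra_simps)
    also have "\<dots> = (\<Sum>n<p. legendre p n) + (\<Sum>n<j * p + i. legendre p (p + n))"
      by (rule split)
    also have "(\<Sum>n<j * p + i. legendre p (p + n)) = (\<Sum>n<j * p + i. legendre p n)"
      by (intro sum.cong refl legendre_cong) (simp add: cong_def)
    finally show ?case using Suc.IH by (simp add: sum_legendre_period)
  qed simp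
  from this[of "Suc N div p" "Suc N mod p"]
  have "(\<Sum>n<Suc N. legendre p n) = (\<Sum>n<Suc N mod p. legendre p n)" by simp
  \<comment> \<open>Periods start at 0; the additional term vanishes because p divides 0.\<close>
  moreover have "(\<Sum>n<Suc N. legendre p n) = (\<Sum>n=1..N. legendre p n)"
    by (rule sum.mono_neutral_right) (auto simp: legendre_eq_0_iff Suc_le_eq)
  moreover have "\<bar>\<Sum>n<Suc N mod p. legendre p n\<bar> \<le> (\<Sum>n<Suc N mod p. 1)"
    by (rule order_trans[OF sum_abs]) (intro sum_mono abs_legendre_le)
  moreover have "(\<Sum>n<Suc N mod p. 1) \<le> real p" using p by (simp add: less_imp_le)
  ultimately show ?thesis by linarith
qed

text \<open>The value at $p$ is changed to $1$ so that no Moebius coefficient is supported on multiples of $p$,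
  for which the residue class $-p$ is not primitive.\<close>
definition legendre_ext :: "nat \<Rightarrow> real" where
  "legendre_ext m = legendre p (m div p ^ multiplicity p m)"

lemma legendre_ext_eq: "\<not> p dvd m \<Longrightarrow> legendre_ext m = legendre p m"
  by (simp add: legendre_ext_def not_dvd_imp_multiplicity_0)

lemma legendre_ext_p: "legendre_ext p = 1"
proof -
  have "multiplicity p p = 1" using p by (simp add: prime_gt_0_nat not_prime_unit)
  then have "legendre_ext p = legendre p 1" using p by (simp add: legendre_ext_def)
  then show ?thesis by (simp only: legendre_1)
qed

lemma sign_function_legendre_ext: "sign_function legendre_ext"
proof
  have unit: "\<not> is_unit p" using p by simp
  fix m n :: nat assume mn: "m > 0" "n > 0"
  obtain m' where m': "m = p ^ multiplicity p m * m'" "\<not> p dvd m'"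
    using multiplicity_decompose'[of m p] mn unit by auto
  obtain n' where n': "n = p ^ multiplicity p n * n'" "\<not> p dvd n'"
    using multiplicity_decompose'[of n p] mn unit by auto
  have p0: "p ^ j > 0" for j using p by simp
  have "m div p ^ multiplicity p m = m'" "n div p ^ multiplicity p n = n'"
    using m' n' p0 by (metis nonzero_mult_div_cancel_left less_irrefl)+
  moreover have "m * n div p ^ multiplicity p (m * n) = m' * n'"
  proof -
    have "multiplicity p (m * n) = multiplicity p m + multiplicity p n"
      using p mn by (intro prime_elem_multiplicity_mult_distrib) auto
    moreover have "m * n = p ^ (multiplicity p m + multiplicity p n) * (m' * n')"
      using m' n' by (metis power_add mult.assoc mult.left_commute)
    ultimately show ?thesis using p0 by (metis nonzero_mult_div_cancel_left less_irrefl)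
  qed
  ultimately show "legendre_ext (m * n) = legendre_ext m * legendre_ext n"
    by (simp add: legendre_ext_def legendre_mult)
next
  have unit: "\<not> is_unit p" using p by simp
  fix m :: nat assume m: "m > 0"
  have "\<not> p dvd m div p ^ multiplicity p m"
    using m unit by (simp add: multiplicity_decompose)
  then have "legendre p (m div p ^ multiplicity p m) \<noteq> 0" by (simp add: legendre_eq_0_iff)
  then show "\<bar>legendre_ext m\<bar> = 1"
    using legendre_values[of p "m div p ^ multiplicity p m"] by (auto simp: legendre_ext_def)
qed

lemma legendre_ext_shift: "\<not> p dvd n \<Longrightarrow> legendre_ext (n + p) = legendre p n"
  using legendre_cong[of "n + p" n p] by (simp add: legendre_ext_eq cong_def)

text \<open>Up to p^4 the only prime powers divisible by p are p, p^2, p^3 and p^4, each of weight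
  ln p.\<close>

lemma sum_mangoldt_multiples_le:
  assumes "N \<le> p ^ 4"
  shows "(\<Sum>n\<in>{n\<in>{1..N}. p dvd n}. mangoldt n) \<le> 4 * real p"
proof -
  have sub: "{n\<in>{1..N}. p dvd n \<and> primepow n} \<subseteq> (\<lambda>j. p ^ j) ` {1..4}"
  proof
    fix n assume n: "n \<in> {n\<in>{1..N}. p dvd n \<and> primepow n}"
    then obtain q j where q: "prime q" "j > 0" "n = q ^ j" by (auto simp: primepow_def)
    have "p dvd q" using n q p by (auto dest: prime_dvd_power)
    then have "p = q" using p q by (simp add: primes_dvd_imp_eq)
    moreover have "p ^ j \<le> p ^ 4" using n q assms calculation by auto
    then have "j \<le> 4" using p by (simp add: power_le_imp_le_exp)
    ultimately show "n \<in> (\<lambda>j. p ^ j) ` {1..4}" using q by auto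
  qed
  have "(\<Sum>n\<in>{n\<in>{1..N}. p dvd n}. mangoldt n :: real) = (\<Sum>n\<in>{n\<in>{1..N}. p dvd n \<and> primepow n}. mangoldt n)"
    by (rule sum.mono_neutral_right) (auto simp: mangoldt_def)
  also have "\<dots> \<le> (\<Sum>n\<in>(\<lambda>j. p ^ j) ` {1..4}. mangoldt n)"
    using sub by (intro sum_mono2) (auto simp: mangoldt_nonneg)
  also have "\<dots> \<le> (\<Sum>j\<in>{1..4}. (mangoldt \<circ> (\<lambda>j. p ^ j)) j)"
    by (rule sum_image_le) (auto simp: mangoldt_nonneg)
  also have "\<dots> = (\<Sum>j\<in>{1..4::nat}. ln (real p))"
    using p by (intro sum.cong) (auto simp del: power_Suc)
  also have "\<dots> \<le> 4 * real p" using p ln_bound[of "real p"] by simp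
  finally show ?thesis .
qed

end

text \<open>Take h = p and b = eps / 4, so that N <= p^4 gives N^b <= p^eps < n(p). Returning from
  \<open>legendre_ext\<close> at n + p to \<open>legendre\<close> at n affects only the multiples of
  p, and the unweighted character sum is at most p; as N >= p^2, all these errors are O(N /
  p).\<close>

lemma sum_mangoldt_legendre_small:
  assumes "elliott_halberstam" "0 < \<epsilon>" "\<epsilon> \<le> 1" "\<kappa> > 0"
  obtains p0 where "\<And>p N. p \<ge> p0 \<Longrightarrow> prime p \<Longrightarrow> p > 2 \<Longrightarrow> real p powr \<epsilon> < real (least_nonres p) \<Longrightarrow>
     p ^ 2 \<le> N \<Longrightarrow> N \<le> p ^ 4 \<Longrightarrow> \<bar>\<Sum>n=1..N. legendre p n * mangoldt n\<bar> \<le> \<kappa> * real N"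
proof -
  obtain N0 where N0: "\<And>N h g. N \<ge> N0 \<Longrightarrow> sign_function g \<Longrightarrow> prime h \<Longrightarrow> g h = 1 \<Longrightarrow> h \<le> N \<Longrightarrow>
      real N powr (\<epsilon> / 4) \<le> real h \<Longrightarrow> (\<And>q. prime q \<Longrightarrow> real q < real N powr (\<epsilon> / 4) \<Longrightarrow> g q = 1) \<Longrightarrow>
      \<bar>(\<Sum>n=1..N. mangoldt n * g (n + h)) - (\<Sum>n=1..N. g (n + h))\<bar> \<le> \<kappa> / 2 * real N"
    using sum_mangoldt_sign_function_approx[OF assms(1), of "\<epsilon> / 4" "\<kappa> / 2"] assms(2-4) by auto
  have "\<bar>\<Sum>n=1..N. legendre p n * mangoldt n\<bar> \<le> \<kappa> * real N"
    if pp: "p \<ge> max N0 (nat \<lceil>16 / \<kappa>\<rceil>)" and p: "prime p" "p > 2" and np: "real p powr \<epsilon> < real (least_nonres p)"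
      and N: "p ^ 2 \<le> N" "N \<le> p ^ 4" for p N
  proof -
    let ?g = "legendre_ext p"
    have pN: "p \<le> N" using N p by (metis le_trans power2_nat_le_imp_le)
    have p16: "16 / \<kappa> \<le> real p" using pp real_nat_ceiling_ge[of "16 / \<kappa>"] by linarith
    have "real N powr (\<epsilon> / 4) \<le> (real p ^ 4) powr (\<epsilon> / 4)"
      using N assms(2) by (intro powr_mono2) (auto simp flip: of_nat_power)
    also have "\<dots> = real p powr \<epsilon>" using p by (simp add: powr_realpow[symmetric] powr_powr flip: powr_numeral)
    finally have Ne: "real N powr (\<epsilon> / 4) \<le> real p powr \<epsilon>" .
    have pe: "real p powr \<epsilon> \<le> real p" using p assms(3) powr_mono[of \<epsilon> 1 "real p"] by simp
    have key: "\<bar>(\<Sum>n=1..N. mangoldt n * ?g (n + p)) - (\<Sum>n=1..N. ?g (n + p))\<bar> \<le> \<kappa> / 2 * real N"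
    proof (rule N0)
      show "N \<ge> N0" using pp pN by simp
      show "sign_function ?g" by (rule sign_function_legendre_ext[OF p])
      show "?g p = 1" by (rule legendre_ext_p[OF p])
      show "real N powr (\<epsilon> / 4) \<le> real p" using Ne pe by simp
      show "?g q = 1" if q: "prime q" "real q < real N powr (\<epsilon> / 4)" for q
      proof -
        have "real q < real (least_nonres p)" "real q < real p" using q Ne pe np by linarith+
        then have q2: "q < least_nonres p" "q < p" by auto
        have "\<not> p dvd q" using q2 prime_gt_0_nat[OF q(1)] by (auto dest: dvd_imp_le)
        then show ?thesis using q2 q prime_gt_0_nat[OF q(1)] 
          by (simp add: legendre_ext_eq[OF p] legendre_eq_1_below_least_nonres[OF p])
      qed
    qed (use p pN in auto)
    let ?P = "{n\<in>{1..N}. p dvd n}"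
    have diff: "\<bar>(\<Sum>n=1..N. w n * ?g (n + p)) - (\<Sum>n=1..N. legendre p n * w n)\<bar> \<le> (\<Sum>n\<in>?P. w n)"
      if w: "\<And>n. w n \<ge> 0" for w :: "nat \<Rightarrow> real"
    proof -
      have "(\<Sum>n=1..N. w n * ?g (n + p)) - (\<Sum>n=1..N. legendre p n * w n) = (\<Sum>n=1..N. w n * (?g (n + p) - legendre p n))"
        by (simp add: sum_subtractf[symmetric] algebra_simps)
      also have "\<dots> = (\<Sum>n\<in>?P. w n * (?g (n + p) - legendre p n))"
        by (rule sum.mono_neutral_right) (auto simp: legendre_ext_shift[OF p])
      finally have "\<bar>(\<Sum>n=1..N. w n * ?g (n + p)) - (\<Sum>n=1..N. legendre p n * w n)\<bar> \<le> (\<Sum>n\<in>?P. \<bar>w n * (?g (n + p) - legendre p n)\<bar>)"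
        by (simp add: sum_abs)
      also have "\<dots> \<le> (\<Sum>n\<in>?P. w n)"
      proof (rule sum_mono)
        fix n assume n: "n \<in> ?P"
        have "\<bar>?g (n + p)\<bar> = 1" using sign_function.abs_eq_1[OF sign_function_legendre_ext[OF p]] p by simp
        moreover have "legendre p n = 0" using n by (simp add: legendre_eq_0_iff)
        ultimately show "\<bar>w n * (?g (n + p) - legendre p n)\<bar> \<le> w n" using w[of n] by (simp add: abs_mult)
      qed
      finally show ?thesis .
    qed
    have d1: "\<bar>(\<Sum>n=1..N. mangoldt n * ?g (n + p)) - (\<Sum>n=1..N. legendre p n * mangoldt n)\<bar> \<le> 4 * real p"
      using diff[of mangoldt] sum_mangoldt_multiples_le[OF p N(2)] mangoldt_nonneg by fastforce
    have "(\<Sum>n\<in>?P. 1) = real (N div p)" using card_multiples[of p N] p by simp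
    also have "\<dots> \<le> real N / real p" by (rule of_nat_div_le_of_nat)
    finally have "(\<Sum>n\<in>?P. 1) \<le> real N / real p" .
    then have d2: "\<bar>(\<Sum>n=1..N. ?g (n + p)) - (\<Sum>n=1..N. legendre p n)\<bar> \<le> real N / real p"
      using diff[of "\<lambda>_. 1"] by simp
    have d3: "\<bar>\<Sum>n=1..N. legendre p n\<bar> \<le> real p" by (rule abs_sum_legendre_le[OF p])
    have "real p * real p \<le> real N" using N(1) by (metis of_nat_le_iff of_nat_mult power2_eq_square)
    then have pn: "real p \<le> real N / real p" using p by (simp add: field_simps)
    have "real N / real p \<le> \<kappa> / 16 * real N"
    proof -
      have "1 / real p \<le> \<kappa> / 16" using p16 p assms(4) by (simp add: field_simps)
      then show ?thesis using mult_right_mono[of "1 / real p" "\<kappa> / 16" "real N"] by simp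
    qed
    \<comment> \<open>Naming the product makes the remaining inequalities linear.\<close>
    moreover define e where "e = \<kappa> * real N"
    then have "\<kappa> / 2 * real N = e / 2" "\<kappa> / 16 * real N = e / 16" by simp_all
    ultimately show ?thesis using key d1 d2 d3 pn unfolding e_def[symmetric] by linarith
  qed
  then show thesis using that by blast
qed

section \<open>Generating functions of the character\<close>

lemma norm_exp_minus_1_le: "norm (exp w - 1) \<le> norm w * exp (norm w)" for w :: complex
proof -
  have "norm (exp w - exp 0) \<le> exp (norm w) * norm (w - 0)"
  proof (rule field_differentiable_bound[of "cball 0 (norm w)" exp exp])
    fix z :: complex assume "z \<in> cball 0 (norm w)"
    then have "Re z \<le> norm w" using complex_Re_le_cmod[of z] by (simp add: order_trans)
    then show "norm (exp z) \<le> exp (norm w)" by simp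
  qed (auto intro: DERIV_subset[OF DERIV_exp])
  then show ?thesis by (simp add: mult.commute)
qed

lemma abel_summation:
  fixes c \<phi> :: "nat \<Rightarrow> complex"
  assumes "m \<le> X"
  shows "(\<Sum>n\<in>{m<..X}. c n * \<phi> n) = (\<Sum>k=1..X. c k) * \<phi> X - (\<Sum>k=1..m. c k) * \<phi> m
           - (\<Sum>n\<in>{m..<X}. (\<Sum>k=1..n. c k) * (\<phi> (Suc n) - \<phi> n))"
  using assms
proof (induction X rule: dec_induct)
  case (step X)
  have "{m<..Suc X} = insert (Suc X) {m<..X}" using step.hyps by auto
  then have "(\<Sum>n\<in>{m<..Suc X}. c n * \<phi> n) = c (Suc X) * \<phi> (Suc X) + (\<Sum>n\<in>{m<..X}. c n * \<phi> n)" by simp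
  then show ?case using step by (simp add: algebra_simps)
qed simp

text \<open>Abel summation: each boundary term costs kappa A and the step at n costs kappa A / n.
  The partial sums are controlled only from Y on, hence m >= Y.\<close>

lemma partial_summation_bound:
  fixes c :: "nat \<Rightarrow> real" and \<phi> :: "nat \<Rightarrow> complex"
  assumes c: "\<And>N. Y \<le> N \<Longrightarrow> N \<le> X \<Longrightarrow> \<bar>\<Sum>n=1..N. c n\<bar> \<le> \<kappa> * real N"
    and \<phi>: "\<And>n. 1 \<le> n \<Longrightarrow> n \<le> X \<Longrightarrow> norm (\<phi> n) \<le> A / real n"
      "\<And>n. 1 \<le> n \<Longrightarrow> n < X \<Longrightarrow> norm (\<phi> (Suc n) - \<phi> n) \<le> A / (real n)\<^sup>2"
    and "1 \<le> Y" "Y \<le> m" "m \<le> X" "A \<ge> 0" "\<kappa> \<ge> 0"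
  shows "norm (\<Sum>n\<in>{m<..X}. of_real (c n) * \<phi> n) \<le> \<kappa> * A * (2 + (\<Sum>n=1..X. 1 / real n))"
proof -
  define D where "D = (\<lambda>N. \<Sum>n=1..N. complex_of_real (c n))"
  have D: "norm (D N) \<le> \<kappa> * real N" if "Y \<le> N" "N \<le> X" for N
  proof -
    have "D N = of_real (\<Sum>n=1..N. c n)" by (simp add: D_def)
    then show ?thesis using c[OF that] by (simp only: norm_of_real)
  qed
  have 1: "norm (D N * \<phi> N) \<le> \<kappa> * A" if "Y \<le> N" "N \<le> X" for N
  proof -
    have "norm (D N * \<phi> N) \<le> (\<kappa> * real N) * (A / real N)"
      unfolding norm_mult using that assms by (intro mult_mono D \<phi>) auto
    then show ?thesis using that assms by simp
  qed
  have "norm (\<Sum>n\<in>{m..<X}. D n * (\<phi> (Suc n) - \<phi> n)) \<le> (\<Sum>n\<in>{m..<X}. \<kappa> * A * (1 / real n))"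
  proof (rule sum_norm_le)
    fix n assume n: "n \<in> {m..<X}"
    have "norm (D n * (\<phi> (Suc n) - \<phi> n)) \<le> (\<kappa> * real n) * (A / (real n)\<^sup>2)"
      unfolding norm_mult using n assms by (intro mult_mono D \<phi>) auto
    also have "\<dots> = \<kappa> * A * (1 / real n)" by (simp add: power2_eq_square)
    finally show "norm (D n * (\<phi> (Suc n) - \<phi> n)) \<le> \<kappa> * A * (1 / real n)" .
  qed
  also have "\<dots> \<le> \<kappa> * A * (\<Sum>n=1..X. 1 / real n)"
    unfolding sum_distrib_left[symmetric] using assms by (intro mult_left_mono sum_mono2) auto
  finally have 2: "norm (\<Sum>n\<in>{m..<X}. D n * (\<phi> (Suc n) - \<phi> n)) \<le> \<kappa> * A * (\<Sum>n=1..X. 1 / real n)" .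
  have "(\<Sum>n\<in>{m<..X}. of_real (c n) * \<phi> n) = D X * \<phi> X - D m * \<phi> m - (\<Sum>n\<in>{m..<X}. D n * (\<phi> (Suc n) - \<phi> n))"
    unfolding D_def by (rule abel_summation) fact
  also have "norm \<dots> \<le> norm (D X * \<phi> X) + norm (D m * \<phi> m) + norm (\<Sum>n\<in>{m..<X}. D n * (\<phi> (Suc n) - \<phi> n))"
    by (rule order_trans[OF norm_triangle_ineq4 add_right_mono[OF norm_triangle_ineq4]])
  also have "\<dots> \<le> \<kappa> * A + \<kappa> * A + \<kappa> * A * (\<Sum>n=1..X. 1 / real n)"
    using assms by (intro add_mono 1 2) auto
  finally show ?thesis by (simp add: algebra_simps)
qed

text \<open>This is n^(z / ln p - 1). The scaling by ln p bounds the factor n^(z / ln p) by exp (4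
  |z|) up to n = p^4, uniformly in p.\<close>

definition twist :: "nat \<Rightarrow> complex \<Rightarrow> nat \<Rightarrow> complex" where
  "twist p z n = exp (z * of_real (ln (real n) / ln (real p))) / of_nat n"

definition genfun :: "nat \<Rightarrow> (nat \<Rightarrow> real) \<Rightarrow> complex \<Rightarrow> complex" where
  "genfun p c z = (\<Sum>n=1..p ^ 4. of_real (c n) * twist p z n) / of_real (ln (real p))"

section \<open>Uniform estimates for the twists and generating functions\<close>

lemma twist_mult: "a > 0 \<Longrightarrow> b > 0 \<Longrightarrow> twist p z (a * b) = twist p z a * twist p z b"
  by (simp add: twist_def ln_mult add_divide_distrib distrib_left exp_add)

lemma ln_prime_ge_1: "p > 2 \<Longrightarrow> ln (real p) \<ge> 1"
proof -
  assume "p > 2"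
  then have "3 \<le> real p" by simp
  then have "exp 1 \<le> real p" using exp_le by linarith
  then show ?thesis using \<open>p > 2\<close> by (simp add: ln_ge_iff)
qed

lemma norm_twist_le:
  assumes "p > 2" "1 \<le> n" "n \<le> p ^ 4"
  shows "norm (twist p z n) \<le> exp (4 * norm z) / real n"
proof -
  have l: "ln (real p) \<ge> 1" by (rule ln_prime_ge_1) fact
  have "ln (real n) \<le> ln (real (p ^ 4))" using assms by (intro ln_mono) auto
  then have "ln (real n) \<le> 4 * ln (real p)" using assms by (simp add: ln_realpow)
  then have 1: "ln (real n) / ln (real p) \<le> 4" using l by (simp add: field_simps)
  have 0: "0 \<le> ln (real n) / ln (real p)" using l assms by simp
  have "Re z * (ln (real n) / ln (real p)) \<le> norm z * 4"
    using 0 1 complex_Re_le_cmod[of z] by (intro mult_mono) auto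
  then show ?thesis using assms by (simp add: twist_def norm_divide divide_right_mono mult.commute)
qed

text \<open>With s = z / ln p - 1 the twist is n^s; consecutive values differ by the factor exp w,
  where w = s (ln (n + 1) - ln n) has norm at most (|z| + 1) / n.\<close>

lemma norm_twist_diff_le:
  assumes "p > 2" "1 \<le> n" "n < p ^ 4"
  shows "norm (twist p z (Suc n) - twist p z n) \<le> (norm z + 1) * exp (norm z + 1) * exp (4 * norm z) / (real n)\<^sup>2"
proof -
  have l: "ln (real p) \<ge> 1" by (rule ln_prime_ge_1) fact
  define s where "s = z / of_real (ln (real p)) - 1"
  have twist_s: "twist p z k = exp (s * of_real (ln (real k)))" if "k > 0" for k
  proof -
    have "exp (complex_of_real (ln (real k))) = of_nat k"
      unfolding exp_of_real using that by simp
    then show ?thesis by (simp add: twist_def s_def algebra_simps exp_diff)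
  qed
  define w where "w = s * of_real (ln (real (Suc n)) - ln (real n))"
  have s: "norm s \<le> norm z + 1"
  proof -
    have "norm s \<le> norm z / ln (real p) + 1"
      unfolding s_def using l by (rule_tac order_trans[OF norm_triangle_ineq4]) (simp add: norm_divide)
    also have "norm z / ln (real p) \<le> norm z / 1" using l by (intro divide_left_mono) auto
    finally show ?thesis by simp
  qed
  have "ln (real (Suc n)) - ln (real n) = ln (1 + 1 / real n)"
  proof -
    have "1 + 1 / real n = real (Suc n) / real n" using assms by (simp add: field_simps)
    then show ?thesis using assms ln_div[of "real (Suc n)" "real n"] by simp
  qed
  also have "\<dots> \<le> 1 / real n" using assms by (intro ln_add_one_self_le_self) simp
  finally have d: "ln (real (Suc n)) - ln (real n) \<le> 1 / real n" .
  have d0: "0 \<le> ln (real (Suc n)) - ln (real n)" using assms by simp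
  have "norm w \<le> (norm z + 1) * (1 / real n)"
    unfolding w_def norm_mult norm_of_real using d d0 s by (intro mult_mono) auto
  then have w: "norm w \<le> (norm z + 1) / real n" by simp
  also have "\<dots> \<le> (norm z + 1) / 1" using assms by (intro divide_left_mono) auto
  finally have w1: "norm w \<le> norm z + 1" by simp
  have "twist p z (Suc n) - twist p z n = twist p z n * (exp w - 1)"
    using assms by (simp add: twist_s w_def algebra_simps exp_add exp_diff)
  also have "norm \<dots> \<le> (exp (4 * norm z) / real n) * ((norm z + 1) / real n * exp (norm z + 1))"
    unfolding norm_mult
  proof (rule mult_mono)
    show "norm (twist p z n) \<le> exp (4 * norm z) / real n" using assms by (intro norm_twist_le) auto
    show "norm (exp w - 1) \<le> (norm z + 1) / real n * exp (norm z + 1)"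
      by (rule order_trans[OF norm_exp_minus_1_le]) (use w w1 in \<open>intro mult_mono; simp\<close>)
  qed auto
  also have "\<dots> = (norm z + 1) * exp (norm z + 1) * exp (4 * norm z) / (real n)\<^sup>2"
    by (simp add: power2_eq_square)
  finally show ?thesis .
qed

lemma sum_norm_twist_le:
  assumes "p > 2" "\<And>n. n \<in> {1..p ^ 4} \<Longrightarrow> \<bar>c n\<bar> \<le> u n" "(\<Sum>n=1..p ^ 4. u n / real n) \<le> K * ln (real p)"
  shows "(\<Sum>n=1..p ^ 4. norm (of_real (c n) * twist p z n)) \<le> K * exp (4 * norm z) * ln (real p)"
proof -
  have "(\<Sum>n=1..p ^ 4. norm (of_real (c n) * twist p z n)) \<le> (\<Sum>n=1..p ^ 4. exp (4 * norm z) * (u n / real n))"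
  proof (rule sum_mono)
    fix n assume n: "n \<in> {1..p ^ 4}"
    have "norm (of_real (c n) * twist p z n) \<le> u n * (exp (4 * norm z) / real n)"
      unfolding norm_mult norm_of_real using n assms(1) assms(2)[OF n] abs_ge_zero[of "c n"]
      by (intro mult_mono norm_twist_le) auto
    then show "norm (of_real (c n) * twist p z n) \<le> exp (4 * norm z) * (u n / real n)" by (simp add: mult.commute)
  qed
  also have "\<dots> \<le> exp (4 * norm z) * (K * ln (real p))"
    unfolding sum_distrib_left[symmetric] using assms(3) by (intro mult_left_mono) auto
  finally show ?thesis by (simp add: mult_ac)
qed

text \<open>The division by ln p cancels the logarithmic growth of the sum of u n / n; the bound is
  uniform in p, as Montel's theorem demands.\<close>

lemma norm_genfun_le:
  assumes "p > 2" "\<And>n. n \<in> {1..p ^ 4} \<Longrightarrow> \<bar>c n\<bar> \<le> u n" "(\<Sum>n=1..p ^ 4. u n / real n) \<le> K * ln (real p)"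
  shows "norm (genfun p c z) \<le> K * exp (4 * norm z)"
proof -
  have l: "ln (real p) \<ge> 1" by (rule ln_prime_ge_1) fact
  have "norm (\<Sum>n=1..p ^ 4. of_real (c n) * twist p z n) \<le> K * exp (4 * norm z) * ln (real p)"
    by (rule order_trans[OF norm_sum sum_norm_twist_le]) fact+
  then show ?thesis using l by (simp add: genfun_def norm_divide field_simps)
qed

lemma harm_pow4_le: "p > 2 \<Longrightarrow> (\<Sum>n=1..p ^ 4. 1 / real n) \<le> 5 * ln (real p)"
  using harm_le[of "p ^ 4"] ln_prime_ge_1[of p] by (simp add: ln_realpow)

lemma abs_legendre_mangoldt_le: "\<bar>legendre p n * mangoldt n\<bar> \<le> mangoldt n"
  using mult_right_mono[OF abs_legendre_le[of p n] mangoldt_nonneg[of n]] by (simp add: abs_mult)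

lemma mangoldt_pow4_le:
  assumes "p > 2" "\<And>N. (\<Sum>n=1..N. mangoldt n) \<le> C * real N" "C \<ge> 1"
  shows "(\<Sum>n=1..p ^ 4. mangoldt n / real n) \<le> (4 + C) * ln (real p)"
proof -
  have l: "ln (real p) \<ge> 1" by (rule ln_prime_ge_1) fact
  have "(\<Sum>n=1..p ^ 4. mangoldt n / real n) \<le> ln (real (p ^ 4)) + C"
    using mertens_upper[OF assms(2), of "real (p ^ 4)"] assms(1)
    by (simp only: floor_of_nat nat_int) (simp add: Suc_le_eq)
  also have "\<dots> \<le> 4 * ln (real p) + C * ln (real p)"
    using l assms by (simp add: ln_realpow)
  finally show ?thesis by (simp add: algebra_simps)
qed

section \<open>The approximate differential equation\<close>

lemma has_field_derivative_genfun:
  assumes "p > 2"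
  shows "(genfun p c has_field_derivative
           (\<Sum>n=1..p ^ 4. of_real (c n * ln (real n)) * twist p z n) / of_real (ln (real p)) ^ 2) (at z)"
proof -
  have l: "ln (real p) \<ge> 1" by (rule ln_prime_ge_1) fact
  have "(genfun p c has_field_derivative
     (\<Sum>n=1..p ^ 4. of_real (c n) * (twist p z n * of_real (ln (real n) / ln (real p)))) / of_real (ln (real p))) (at z)"
    unfolding genfun_def[abs_def]
  proof (intro DERIV_cdivide DERIV_sum DERIV_cmult)
    fix n
    show "((\<lambda>z. twist p z n) has_field_derivative twist p z n * of_real (ln (real n) / ln (real p))) (at z)"
      unfolding twist_def by (auto intro!: derivative_eq_intros simp: divide_inverse mult_ac)
  qed
  also have "(\<Sum>n=1..p ^ 4. of_real (c n) * (twist p z n * of_real (ln (real n) / ln (real p)))) / of_real (ln (real p))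
     = (\<Sum>n=1..p ^ 4. of_real (c n * ln (real n)) * twist p z n) / of_real (ln (real p)) ^ 2"
    using l by (simp add: sum_divide_distrib power2_eq_square mult_ac)
  finally show ?thesis .
qed

lemma holomorphic_genfun: "p > 2 \<Longrightarrow> genfun p c holomorphic_on UNIV"
  using has_field_derivative_genfun by (auto simp: holomorphic_on_open)

text \<open>Expand ln n as the sum of Lambda over the divisors of n; character and twist are
  completely multiplicative, so n = a b separates, and the cutoff n <= X becomes the region under a
  hyperbola.\<close>

lemma sum_legendre_ln_twist:
  assumes "prime p" "p > 2"
  shows "(\<Sum>n=1..X. of_real (legendre p n * ln (real n)) * twist p z n)
    = (\<Sum>b=1..X. \<Sum>a\<in>{a\<in>{1..X}. a * b \<le> X}. (of_real (legendre p a) * twist p z a) * (of_real (legendre p b * mangoldt b) * twist p z b))"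
proof -
  let ?F = "\<lambda>a. of_real (legendre p a) * twist p z a" and ?G = "\<lambda>b. of_real (legendre p b * mangoldt b) * twist p z b"
  have "(\<Sum>n=1..X. of_real (legendre p n * ln (real n)) * twist p z n)
      = (\<Sum>n=1..X. \<Sum>b\<in>{b\<in>{1..X}. b dvd n}. ?F (n div b) * ?G b)"
  proof (rule sum.cong[OF refl])
    fix n assume n: "n \<in> {1..X}"
    have div: "{b. b dvd n} = {b\<in>{1..X}. b dvd n}"
      using n by (auto dest: dvd_imp_le intro!: Nat.gr0I simp: Suc_le_eq)
    have "ln (real n) = (\<Sum>b\<in>{b\<in>{1..X}. b dvd n}. mangoldt b)"
      using mangoldt_sum[of n, where 'a = real] n unfolding div by simp
    then have "of_real (legendre p n * ln (real n)) * twist p z n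
        = (\<Sum>b\<in>{b\<in>{1..X}. b dvd n}. of_real (legendre p n * mangoldt b) * twist p z n)"
      by (simp add: sum_distrib_left sum_distrib_right)
    also have "\<dots> = (\<Sum>b\<in>{b\<in>{1..X}. b dvd n}. ?F (n div b) * ?G b)"
    proof (rule sum.cong[OF refl])
      fix b assume b: "b \<in> {b\<in>{1..X}. b dvd n}"
      then obtain a where a: "n = a * b" by (metis dvd_def mem_Collect_eq mult.commute)
      have ab: "a > 0" "b > 0" using a n by (auto intro!: Nat.gr0I)
      have "n div b = a" using a ab by simp
      then show "of_real (legendre p n * mangoldt b) * twist p z n = ?F (n div b) * ?G b"
        using ab by (simp add: a legendre_mult[OF assms] twist_mult mult_ac)
    qed
    finally show "of_real (legendre p n * ln (real n)) * twist p z n = (\<Sum>b\<in>{b\<in>{1..X}. b dvd n}. ?F (n div b) * ?G b)" .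
  qed
  also have "\<dots> = (\<Sum>n=1..X. \<Sum>b=1..X. if b dvd n then ?F (n div b) * ?G b else 0)"
    by (rule sum.cong[OF refl]) (rule sum.inter_filter, simp)
  also have "\<dots> = (\<Sum>b=1..X. \<Sum>n=1..X. if b dvd n then ?F (n div b) * ?G b else 0)"
    by (rule sum.swap)
  also have "\<dots> = (\<Sum>b=1..X. \<Sum>n\<in>{n\<in>{1..X}. b dvd n}. ?F (n div b) * ?G b)"
    by (rule sum.cong[OF refl]) (rule sum.inter_filter[symmetric], simp)
  also have "\<dots> = (\<Sum>b=1..X. \<Sum>a\<in>{a\<in>{1..X}. a * b \<le> X}. ?F a * ?G b)"
  proof (rule sum.cong[OF refl])
    fix b assume b: "b \<in> {1..X}"
    show "(\<Sum>n\<in>{n\<in>{1..X}. b dvd n}. ?F (n div b) * ?G b) = (\<Sum>a\<in>{a\<in>{1..X}. a * b \<le> X}. ?F a * ?G b)"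
    proof (rule sum.reindex_bij_witness[of _ "\<lambda>a. a * b" "\<lambda>n. n div b"])
      fix n assume n: "n \<in> {n\<in>{1..X}. b dvd n}"
      then obtain a where a: "n = a * b" by (metis dvd_def mem_Collect_eq mult.commute)
      have a0: "a > 0" using a n by (auto intro!: Nat.gr0I)
      have "a \<le> n" using b by (simp add: a)
      moreover have "n \<le> X" using n by simp
      ultimately have "a \<le> X" by (rule order_trans)
      then show "n div b * b = n" "n div b \<in> {a\<in>{1..X}. a * b \<le> X}" using a b n a0 by (auto simp: Suc_le_eq)
    next
      fix a assume a: "a \<in> {a\<in>{1..X}. a * b \<le> X}"
      then show "a * b div b = a" "a * b \<in> {n\<in>{1..X}. b dvd n}" using b by (auto simp: Suc_le_eq)
    qed simp
  qed
  finally show ?thesis .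
qed

text \<open>The derivative sums over a b <= p^4, the product over the full square; the difference T
  is small by partial summation. The 7 is 2 + 5, from the boundary terms and the harmonic sum; 9 + C
  is (4 + C) + 5, from the absolute sums over the other variable.\<close>

lemma genfun_deriv_approx:
  assumes p: "prime p" "p > 2" and \<kappa>: "\<kappa> > 0" "1 / real p \<le> \<kappa>"
    and cheb: "\<And>N. (\<Sum>n=1..N. mangoldt n) \<le> C * real N" "C \<ge> 1"
    and small: "\<And>N. p\<^sup>2 \<le> N \<Longrightarrow> N \<le> p ^ 4 \<Longrightarrow> \<bar>\<Sum>n=1..N. legendre p n * mangoldt n\<bar> \<le> \<kappa> * real N"
  shows "norm (deriv (genfun p (legendre p)) z - genfun p (\<lambda>n. legendre p n * mangoldt n) z * genfun p (legendre p) z)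
    \<le> \<kappa> * (7 * (9 + C) * ((norm z + 1) * exp (norm z + 1) * exp (4 * norm z)) * exp (4 * norm z))"
proof -
  let ?F = "\<lambda>a. of_real (legendre p a) * twist p z a" and ?G = "\<lambda>b. of_real (legendre p b * mangoldt b) * twist p z b"
  define X where "X = p ^ 4"
  define Y where "Y = p\<^sup>2"
  define l where "l = ln (real p)"
  define A where "A = (norm z + 1) * exp (norm z + 1) * exp (4 * norm z)"
  have l: "l \<ge> 1" unfolding l_def by (rule ln_prime_ge_1) fact
  have XY: "X = Y * Y" by (simp add: X_def Y_def power2_eq_square numeral_eq_Suc)
  have Y0: "Y \<ge> 1" using p by (simp add: Y_def Suc_le_eq)
  have YX: "Y \<le> X" using Y0 by (simp add: XY)
  have A0: "A \<ge> 0" by (simp add: A_def)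
  define H where "H = \<kappa> * A * (7 * l)"
  have "1 * exp (4 * norm z) \<le> (norm z + 1) * exp (norm z + 1) * exp (4 * norm z)"
    using mult_mono[of 1 "norm z + 1" 1 "exp (norm z + 1)"] by (intro mult_right_mono) auto
  then have Ae: "exp (4 * norm z) \<le> A" by (simp add: A_def)
  have tail: "norm (\<Sum>n\<in>{m<..X}. of_real (c n) * twist p z n) \<le> H"
    if "Y \<le> m" "m \<le> X" and c: "\<And>N. Y \<le> N \<Longrightarrow> N \<le> X \<Longrightarrow> \<bar>\<Sum>n=1..N. c n\<bar> \<le> \<kappa> * real N" for m c
  proof -
    have "norm (\<Sum>n\<in>{m<..X}. of_real (c n) * twist p z n) \<le> \<kappa> * A * (2 + (\<Sum>n=1..X. 1 / real n))"
    proof (rule partial_summation_bound[OF c])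
      fix n assume n: "1 \<le> n" "n \<le> X"
      have "norm (twist p z n) \<le> exp (4 * norm z) / real n" using n p by (intro norm_twist_le) (auto simp: X_def)
      also have "\<dots> \<le> A / real n" by (rule divide_right_mono[OF Ae]) simp
      finally show "norm (twist p z n) \<le> A / real n" .
    next
      fix n assume n: "1 \<le> n" "n < X"
      then show "norm (twist p z (Suc n) - twist p z n) \<le> A / (real n)\<^sup>2"
        unfolding A_def using p by (intro norm_twist_diff_le) (auto simp: X_def)
    qed (use that Y0 A0 \<kappa> in auto)
    also have "\<dots> \<le> H"
      unfolding H_def using harm_pow4_le[OF p(2)] l \<kappa> A0
      by (intro mult_left_mono mult_nonneg_nonneg) (auto simp: X_def l_def)
    finally show ?thesis .
  qed
  have leg: "\<bar>\<Sum>n=1..N. legendre p n\<bar> \<le> \<kappa> * real N" if N: "Y \<le> N" for N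
  proof -
    have "\<bar>\<Sum>n=1..N. legendre p n\<bar> \<le> real p" by (rule abs_sum_legendre_le[OF p])
    also have "real p \<le> \<kappa> * (real p * real p)" using \<kappa> p by (simp add: field_simps)
    also have "\<dots> \<le> \<kappa> * real N" using N \<kappa> unfolding Y_def power2_eq_square
      by (intro mult_left_mono) (auto simp flip: of_nat_mult)
    finally show ?thesis .
  qed
  have sumF: "(\<Sum>a=1..X. norm (?F a)) \<le> 5 * exp (4 * norm z) * l"
    unfolding X_def l_def by (rule sum_norm_twist_le[of p _ "\<lambda>_. 1"]) (use p abs_legendre_le harm_pow4_le in auto)
  have sumG: "(\<Sum>b=1..X. norm (?G b)) \<le> (4 + C) * exp (4 * norm z) * l"
    unfolding X_def l_def
  proof (rule sum_norm_twist_le)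
    show "\<bar>legendre p n * mangoldt n\<bar> \<le> mangoldt n" for n by (rule abs_legendre_mangoldt_le)
    show "(\<Sum>n=1..p ^ 4. mangoldt n / real n) \<le> (4 + C) * ln (real p)"
      by (rule mangoldt_pow4_le[OF p(2) cheb])
  qed (rule p)
  \<comment> \<open>$ab > X = Y^2$ forces $a > Y$ or $b > Y$, and the sum over the larger variable has cancellation\<close>
  define T where "T = (\<Sum>b=1..X. \<Sum>a\<in>{a\<in>{1..X}. X < a * b}. ?F a * ?G b)"
  have gt_iff: "X < a * b \<longleftrightarrow> X div b < a" if "b > 0" for a b
    using that by (simp add: div_less_iff_less_mult)
  \<comment> \<open>For a > Y the sum over a is a tail of chi. For a <= Y the order is exchanged,
    and b runs over a tail of chi Lambda that starts at X div a >= Y.\<close>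
  have "T = (\<Sum>b=1..X. (\<Sum>a\<in>{max Y (X div b)<..X}. ?F a * ?G b) + (\<Sum>a\<in>{a\<in>{1..Y}. X < a * b}. ?F a * ?G b))"
    unfolding T_def
  proof (rule sum.cong[OF refl])
    fix b assume b: "b \<in> {1..X}"
    have eq: "{a\<in>{1..X}. X < a * b} = {max Y (X div b)<..X} \<union> {a\<in>{1..Y}. X < a * b}"
      using b Y0 YX by (auto simp: gt_iff)
    show "(\<Sum>a\<in>{a\<in>{1..X}. X < a * b}. ?F a * ?G b) = (\<Sum>a\<in>{max Y (X div b)<..X}. ?F a * ?G b) + (\<Sum>a\<in>{a\<in>{1..Y}. X < a * b}. ?F a * ?G b)"
      unfolding eq by (rule sum.union_disjoint) auto
  qed
  also have "\<dots> = (\<Sum>b=1..X. ?G b * (\<Sum>a\<in>{max Y (X div b)<..X}. ?F a)) + (\<Sum>a=1..Y. ?F a * (\<Sum>b\<in>{X div a<..X}. ?G b))"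
  proof -
    have "(\<Sum>b=1..X. \<Sum>a\<in>{a\<in>{1..Y}. X < a * b}. ?F a * ?G b) = (\<Sum>b=1..X. \<Sum>a=1..Y. if X < a * b then ?F a * ?G b else 0)"
      by (rule sum.cong[OF refl]) (rule sum.inter_filter, simp)
    also have "\<dots> = (\<Sum>a=1..Y. \<Sum>b=1..X. if X < a * b then ?F a * ?G b else 0)" by (rule sum.swap)
    also have "\<dots> = (\<Sum>a=1..Y. \<Sum>b\<in>{b\<in>{1..X}. X < a * b}. ?F a * ?G b)"
      by (rule sum.cong[OF refl]) (rule sum.inter_filter[symmetric], simp)
    also have "\<dots> = (\<Sum>a=1..Y. ?F a * (\<Sum>b\<in>{X div a<..X}. ?G b))"
      unfolding sum_distrib_left
    proof (rule sum.cong[OF refl])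
      fix a assume "a \<in> {1..Y}"
      then have a0: "a > 0" by simp
      define m where "m = X div a"
      have iff: "X < a * b \<longleftrightarrow> m < b" for b
        using gt_iff[OF a0, of b] unfolding mult.commute[of b a] m_def .
      have "{b\<in>{1..X}. X < a * b} = {X div a<..X}"
        unfolding iff m_def[symmetric] by auto
      then show "(\<Sum>b\<in>{b\<in>{1..X}. X < a * b}. ?F a * ?G b) = (\<Sum>b\<in>{X div a<..X}. ?F a * ?G b)" by simp
    qed
    finally show ?thesis by (simp add: sum.distrib sum_distrib_left mult.commute)
  qed
  finally have T: "T = (\<Sum>b=1..X. ?G b * (\<Sum>a\<in>{max Y (X div b)<..X}. ?F a)) + (\<Sum>a=1..Y. ?F a * (\<Sum>b\<in>{X div a<..X}. ?G b))" .
  have H0: "H \<ge> 0" unfolding H_def using \<kappa> A0 l by simp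
  have "norm (\<Sum>b=1..X. ?G b * (\<Sum>a\<in>{max Y (X div b)<..X}. ?F a)) \<le> (\<Sum>b=1..X. norm (?G b) * H)"
  proof (rule sum_norm_le)
    fix b assume b: "b \<in> {1..X}"
    have "norm (\<Sum>a\<in>{max Y (X div b)<..X}. ?F a) \<le> H"
      by (rule tail) (use YX leg in auto)
    then show "norm (?G b * (\<Sum>a\<in>{max Y (X div b)<..X}. ?F a)) \<le> norm (?G b) * H"
      unfolding norm_mult by (rule mult_left_mono) simp
  qed
  also have "\<dots> \<le> (4 + C) * exp (4 * norm z) * l * H"
    unfolding sum_distrib_right[symmetric] by (rule mult_right_mono[OF sumG H0])
  finally have T1: "norm (\<Sum>b=1..X. ?G b * (\<Sum>a\<in>{max Y (X div b)<..X}. ?F a)) \<le> (4 + C) * exp (4 * norm z) * l * H" .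
  have "norm (\<Sum>a=1..Y. ?F a * (\<Sum>b\<in>{X div a<..X}. ?G b)) \<le> (\<Sum>a=1..Y. norm (?F a) * H)"
  proof (rule sum_norm_le)
    fix a assume a: "a \<in> {1..Y}"
    have "Y \<le> X div a"
    proof -
      have "Y * a \<le> X" using a by (simp add: XY)
      then show ?thesis using a by (simp add: less_eq_div_iff_mult_less_eq)
    qed
    then have "norm (\<Sum>b\<in>{X div a<..X}. ?G b) \<le> H"
      by (intro tail) (use small in \<open>auto simp: X_def Y_def\<close>)
    then show "norm (?F a * (\<Sum>b\<in>{X div a<..X}. ?G b)) \<le> norm (?F a) * H"
      unfolding norm_mult by (rule mult_left_mono) simp
  qed
  also have "\<dots> \<le> (\<Sum>a=1..X. norm (?F a)) * H"
    unfolding sum_distrib_right[symmetric] using YX H0 by (intro mult_right_mono sum_mono2) auto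
  also have "\<dots> \<le> 5 * exp (4 * norm z) * l * H" by (rule mult_right_mono[OF sumF H0])
  finally have T2: "norm (\<Sum>a=1..Y. ?F a * (\<Sum>b\<in>{X div a<..X}. ?G b)) \<le> 5 * exp (4 * norm z) * l * H" .
  have normT: "norm T \<le> (9 + C) * exp (4 * norm z) * l * H"
    unfolding T using norm_triangle_le[OF add_mono[OF T1 T2]] by (simp add: algebra_simps)
  have "(\<Sum>b=1..X. ?G b) * (\<Sum>a=1..X. ?F a) = (\<Sum>a=1..X. ?F a) * (\<Sum>b=1..X. ?G b)"
    by (rule mult.commute)
  also have "\<dots> = (\<Sum>a=1..X. \<Sum>b=1..X. ?F a * ?G b)" by (rule sum_product)
  also have "\<dots> = (\<Sum>b=1..X. \<Sum>a=1..X. ?F a * ?G b)" by (rule sum.swap)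
  also have "\<dots> = (\<Sum>b=1..X. (\<Sum>a\<in>{a\<in>{1..X}. a * b \<le> X}. ?F a * ?G b) + (\<Sum>a\<in>{a\<in>{1..X}. X < a * b}. ?F a * ?G b))"
  proof (rule sum.cong[OF refl])
    fix b
    have eq: "{1..X} = {a\<in>{1..X}. a * b \<le> X} \<union> {a\<in>{1..X}. X < a * b}" by auto
    show "(\<Sum>a=1..X. ?F a * ?G b) = (\<Sum>a\<in>{a\<in>{1..X}. a * b \<le> X}. ?F a * ?G b) + (\<Sum>a\<in>{a\<in>{1..X}. X < a * b}. ?F a * ?G b)"
      by (subst (1) eq, rule sum.union_disjoint) auto
  qed
  also have "\<dots> = (\<Sum>n=1..X. of_real (legendre p n * ln (real n)) * twist p z n) + T"
    unfolding sum_legendre_ln_twist[OF p] T_def by (rule sum.distrib)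
  finally have GF: "(\<Sum>b=1..X. ?G b) * (\<Sum>a=1..X. ?F a) = (\<Sum>n=1..X. of_real (legendre p n * ln (real n)) * twist p z n) + T" .
  have "deriv (genfun p (legendre p)) z = (\<Sum>n=1..X. of_real (legendre p n * ln (real n)) * twist p z n) / of_real l ^ 2"
    unfolding X_def l_def by (rule DERIV_imp_deriv[OF has_field_derivative_genfun[OF p(2)]])
  moreover have "genfun p (\<lambda>n. legendre p n * mangoldt n) z * genfun p (legendre p) z = ((\<Sum>b=1..X. ?G b) * (\<Sum>a=1..X. ?F a)) / of_real l ^ 2"
    by (simp add: genfun_def X_def l_def power2_eq_square)
  ultimately have "deriv (genfun p (legendre p)) z - genfun p (\<lambda>n. legendre p n * mangoldt n) z * genfun p (legendre p) z = - T / of_real l ^ 2"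
    unfolding GF by (simp add: diff_divide_distrib[symmetric])
  then have "norm (deriv (genfun p (legendre p)) z - genfun p (\<lambda>n. legendre p n * mangoldt n) z * genfun p (legendre p) z) = norm T / l ^ 2"
    using l by (simp add: norm_divide norm_power)
  also have "\<dots> \<le> (9 + C) * exp (4 * norm z) * l * H / l ^ 2"
    by (rule divide_right_mono[OF normT]) simp
  also have "\<dots> = \<kappa> * (7 * (9 + C) * A * exp (4 * norm z))"
    using l by (simp add: H_def power2_eq_square)
  finally show ?thesis unfolding A_def .
qed

section \<open>Zero-free entire functions of exponential type\<close>

text \<open>A real part bounded above on the disc of twice the radius controls the modulus at z, so
  the one-sided hypothesis becomes linear growth, and Liouville leaves a polynomial of degree at
  most 1.\<close>

lemma entire_Re_linear_growth_imp_affine: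
  assumes hol: "G holomorphic_on UNIV" and Re: "\<And>z. Re (G z) \<le> A + B * norm z"
  obtains \<alpha> where "\<And>z. G z = G 0 + \<alpha> * z"
proof -
  define F where "F = (\<lambda>z. G z - G 0)"
  \<comment> \<open>The \<open>+ 1\<close> makes the bound on Re F strict and the constant M below
    positive.\<close>
  define A' where "A' = \<bar>A - Re (G 0)\<bar> + 1"
  define B' where "B' = \<bar>B\<bar>"
  have F0: "F 0 = 0" by (simp add: F_def)
  have holF: "F holomorphic_on UNIV" unfolding F_def by (intro holomorphic_intros hol)
  have AB: "A' \<ge> 1" "B' \<ge> 0" by (auto simp: A'_def B'_def)
  have ReF: "Re (F z) < A' + B' * norm z" for z
  proof -
    have "B * norm z \<le> B' * norm z" by (intro mult_right_mono) (auto simp: B'_def)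
    then show ?thesis using Re[of z] by (simp add: F_def A'_def)
  qed
  \<comment> \<open>Borel-Caratheodory: $F / (2 M - F)$ maps the disc of radius $R$ into the unit disc\<close>
  have bound: "norm (F z) \<le> 2 * (A' + B' * (2 * norm z))" if z: "z \<noteq> 0" for z
  proof -
    define R where "R = 2 * norm z"
    define M where "M = A' + B' * R"
    have R: "R > 0" using z by (simp add: R_def)
    have M: "M > 0" using AB R by (auto simp: M_def intro: add_pos_nonneg)
    have ReM: "Re (F w) < M" if "norm w \<le> R" for w
      using ReF[of w] mult_left_mono[OF that AB(2)] by (simp add: M_def)
    have lt: "norm (F w) < norm (2 * of_real M - F w)" if "norm w \<le> R" for w
    proof -
      have "0 < 4 * M * (M - Re (F w))" using M ReM[OF that] by simp
      also have "\<dots> = (2 * M - Re (F w))\<^sup>2 - (Re (F w))\<^sup>2" by (simp add: power2_eq_square algebra_simps)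
      finally have "(norm (F w))\<^sup>2 < (norm (2 * of_real M - F w))\<^sup>2"
        unfolding cmod_power2 by simp
      then show ?thesis by (rule power2_less_imp_less) simp
    qed
    define \<phi> where "\<phi> = (\<lambda>w. F (of_real R * w) / (2 * of_real M - F (of_real R * w)))"
    have le: "norm (of_real R * w) \<le> R" if "norm w < 1" for w :: complex
      using that R by (simp add: norm_mult mult_left_le)
    have nz: "2 * of_real M - F (of_real R * w) \<noteq> 0" if "norm w < 1" for w
      using lt[OF le[OF that]] by (metis norm_ge_zero norm_zero not_less)
    have hol\<phi>: "\<phi> holomorphic_on ball 0 1"
      unfolding \<phi>_def
      by (intro holomorphic_intros holomorphic_on_compose_gen[OF _ holF, unfolded o_def]) (use nz in auto)
    have "norm (\<phi> (z / of_real R)) \<le> norm (z / of_real R)"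
    proof (rule Schwarz_Lemma(1)[OF hol\<phi>])
      show "\<phi> 0 = 0" by (simp add: \<phi>_def F0)
      show "norm (\<phi> w) < 1" if "norm w < 1" for w
        using lt[OF le[OF that]] nz[OF that] by (simp add: \<phi>_def norm_divide)
      show "norm (z / of_real R) < 1" using z by (simp add: R_def norm_divide)
    qed
    also have "norm (z / of_real R) = 1 / 2" using z by (simp add: R_def norm_divide)
    also have "\<phi> (z / of_real R) = F z / (2 * of_real M - F z)" using R by (simp add: \<phi>_def)
    finally have "2 * norm (F z) \<le> norm (2 * of_real M - F z)"
      using lt[of z] R by (simp add: R_def norm_divide divide_le_eq split: if_splits)
    also have "\<dots> \<le> 2 * M + norm (F z)"
      using M by (intro order_trans[OF norm_triangle_ineq4]) (simp add: norm_mult)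
    finally show ?thesis by (simp add: M_def R_def)
  qed
  have aff: "F z = (\<Sum>k\<le>1. (deriv ^^ k) F 0 / fact k * z ^ k)" for z
  proof (rule Liouville_polynomial[OF holF])
    fix z :: complex assume z: "1 \<le> norm z"
    then have "norm (F z) \<le> 2 * (A' + B' * (2 * norm z))" by (intro bound) auto
    also have "\<dots> \<le> 2 * (A' * norm z + B' * (2 * norm z))"
      using AB z mult_left_mono[OF z, of A'] by simp
    finally show "norm (F z) \<le> (2 * A' + 4 * B') * norm z ^ 1" by (simp add: algebra_simps)
  qed
  have "G z = G 0 + deriv F 0 * z" for z
    using aff[of z] F0 by (simp add: F_def diff_eq_eq add.commute)
  then show thesis using that by blast
qed

text \<open>For a primitive H of c the product S exp (-H) is a nonzero constant, so S = exp G with G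
  entire. Then Re G = ln |S| grows at most linearly, and G is affine.\<close>

lemma zero_free_exponential_type:
  assumes hol: "S holomorphic_on UNIV" "c holomorphic_on UNIV"
    and ode: "\<And>z. (S has_field_derivative c z * S z) (at z)"
    and growth: "\<And>z. norm (S z) \<le> K * exp (B * norm z)"
    and nz: "S z1 \<noteq> 0"
  obtains \<alpha> \<beta> where "\<And>z. S z = exp (\<beta> + \<alpha> * z)"
proof -
  obtain H where H: "\<And>z. (H has_field_derivative c z) (at z)"
    by (rule holomorphic_convex_primitive'[of UNIV c]) (auto simp: hol)
  have "\<exists>k. \<forall>z\<in>UNIV. S z * exp (- H z) = k"
  proof (rule has_field_derivative_zero_constant)
    fix z
    have "((\<lambda>z. S z * exp (- H z)) has_field_derivative c z * S z * exp (- H z) + S z * (exp (- H z) * (- c z))) (at z)"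
      by (auto intro!: derivative_eq_intros ode H)
    then show "((\<lambda>z. S z * exp (- H z)) has_field_derivative 0) (at z within UNIV)" by (simp add: mult_ac)
  qed simp
  then obtain k where k: "\<And>z. S z * exp (- H z) = k" by auto
  have k0: "k \<noteq> 0" using k[of z1] nz by auto
  then obtain b where b: "k = exp b" by (metis exp_Ln)
  define G where "G = (\<lambda>z. b + H z)"
  have SG: "S z = exp (G z)" for z
    using k[of z] by (simp add: G_def b exp_add exp_minus field_simps)
  have holG: "G holomorphic_on UNIV"
    unfolding G_def using H by (intro holomorphic_intros) (auto simp: holomorphic_on_open)
  have K: "K > 0" using growth[of z1] nz by (metis exp_gt_zero less_le_trans mult_pos_pos not_less zero_less_mult_pos2 zero_less_norm_iff)
  have "Re (G z) \<le> ln K + B * norm z" for z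
  proof -
    have "exp (Re (G z)) \<le> exp (ln K + B * norm z)"
      using growth[of z] K by (simp add: SG exp_add)
    then show ?thesis by simp
  qed
  then obtain \<alpha> where "\<And>z. G z = G 0 + \<alpha> * z"
    using entire_Re_linear_growth_imp_affine[OF holG] by blast
  then show thesis using that[of "G 0" \<alpha>] SG by metis
qed

section \<open>The limiting argument\<close>

text \<open>Here e n = n^(-s). Both bounds compare s n^(-s-1) with the drop of e between
  neighbouring integers and telescope, a discrete form of integrating t^(-s-1).\<close>

lemma exp_neg_ln_sum_bounds:
  fixes s :: real
  assumes s: "s > 0"
  defines "e \<equiv> \<lambda>n::nat. exp (- (s * ln (real n)))"
  shows "1 - e (Suc U) \<le> s * (\<Sum>n=1..U. e n / real n)"
    and "1 \<le> U \<Longrightarrow> U \<le> X \<Longrightarrow> s * (\<Sum>n\<in>{U<..X}. e n / real n) \<le> e U - e X"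
proof -
  have diff: "e n - e (Suc n) \<le> s * (e n / real n)" "s * (e (Suc n) / real (Suc n)) \<le> e n - e (Suc n)" if "n \<ge> 1" for n
  proof -
    define d where "d = ln (real (Suc n)) - ln (real n)"
    have d: "d = ln (1 + 1 / real n)" "d = - ln (1 - 1 / real (Suc n))"
    proof -
      have "1 + 1 / real n = real (Suc n) / real n" using that by (simp add: field_simps)
      then show "d = ln (1 + 1 / real n)" using that ln_div[of "real (Suc n)" "real n"] by (simp add: d_def)
      have "1 - 1 / real (Suc n) = real n / real (Suc n)" by (simp add: field_simps)
      then show "d = - ln (1 - 1 / real (Suc n))" using that ln_div[of "real n" "real (Suc n)"] by (simp add: d_def)
    qed
    have dle: "d \<le> 1 / real n" unfolding d(1) using that by (intro ln_add_one_self_le_self) simp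
    have dge: "1 / real (Suc n) \<le> d"
      unfolding d(2) using that ln_le_minus_one[of "1 - 1 / real (Suc n)"] by simp
    have e1: "e (Suc n) = e n * exp (- (s * d))" and e2: "e n = e (Suc n) * exp (s * d)"
      by (simp_all add: e_def d_def algebra_simps flip: exp_add)
    have "1 - exp (- (s * d)) \<le> s * d" using exp_ge_add_one_self[of "- (s * d)"] by simp
    also have "\<dots> \<le> s * (1 / real n)" using dle s by (intro mult_left_mono) auto
    finally have "e n * (1 - exp (- (s * d))) \<le> e n * (s * (1 / real n))"
      by (intro mult_left_mono) (auto simp: e_def)
    then show "e n - e (Suc n) \<le> s * (e n / real n)" by (simp add: e1 algebra_simps)
    have "s * (1 / real (Suc n)) \<le> s * d" using dge s by (intro mult_left_mono) auto
    also have "\<dots> \<le> exp (s * d) - 1" using exp_ge_add_one_self[of "s * d"] by linarith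
    finally have "e (Suc n) * (s * (1 / real (Suc n))) \<le> e (Suc n) * (exp (s * d) - 1)"
      by (intro mult_left_mono) (auto simp: e_def)
    also have "\<dots> = e n - e (Suc n)" unfolding right_diff_distrib e2[symmetric] by simp
    finally show "s * (e (Suc n) / real (Suc n)) \<le> e n - e (Suc n)" by (simp add: mult_ac)
  qed
  show "1 - e (Suc U) \<le> s * (\<Sum>n=1..U. e n / real n)"
  proof (induction U)
    case (Suc U)
    then show ?case using diff(1)[of "Suc U"] by (simp add: distrib_left)
  qed (simp add: e_def)
  show "s * (\<Sum>n\<in>{U<..X}. e n / real n) \<le> e U - e X" if "1 \<le> U" "U \<le> X"
    using that(2)
  proof (induction X rule: dec_induct)
    case (step X)
    have "{U<..Suc X} = insert (Suc X) {U<..X}" using step.hyps by auto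
    then show ?case using step diff(2)[of X] that(1) by (simp add: distrib_left)
  qed simp
qed

text \<open>At -v the twist is n^(-1-s) with s = v / ln p <= 1. The terms below n(p), where the
  character is 1, give at least (1 - exp (-eps v)) / s, and the others cost at most 3 exp (-eps v) /
  s. The second bound is the trivial one, 1 + 1 / s <= 2 / s.\<close>

lemma genfun_negative_axis:
  assumes p: "prime p" "p > 2" and e: "\<epsilon> > 0" "real p powr \<epsilon> < real (least_nonres p)"
    and v: "0 < v" "v \<le> ln (real p)"
  shows "(1 - 4 * exp (- (\<epsilon> * v))) / v \<le> Re (genfun p (legendre p) (- of_real v))"
    and "norm (genfun p (legendre p) (- of_real v)) \<le> 2 / v"
proof -
  define l where "l = ln (real p)"
  have l: "l \<ge> 1" unfolding l_def by (rule ln_prime_ge_1) fact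
  define s where "s = v / l"
  have s: "0 < s" "s \<le> 1" using v l by (auto simp: s_def l_def)
  have sl: "s * l = v" using l by (simp add: s_def)
  define r where "r = (\<lambda>n::nat. exp (- (s * ln (real n))) / real n)"
  define X where "X = p ^ 4"
  define U where "U = least_nonres p - 1"
  have r0: "r n \<ge> 0" for n by (simp add: r_def)
  have "1 < real p powr \<epsilon>" using p e by (intro gr_one_powr) auto
  then have "real (least_nonres p) > 1" using e by linarith
  then have U: "U \<ge> 1" "Suc U = least_nonres p" by (auto simp: U_def)
  have "p ^ 1 \<le> p ^ 4" using p by (intro power_increasing) auto
  then have UX: "U \<le> X" using least_nonres_less[OF p] by (simp add: U_def X_def)
  have tw: "twist p (- of_real v) n = of_real (r n)" for n
    by (simp add: twist_def r_def s_def l_def exp_of_real[symmetric])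
  have gf: "genfun p (legendre p) (- of_real v) = of_real ((\<Sum>n=1..X. legendre p n * r n) / l)"
    by (simp add: genfun_def tw X_def l_def)
  have split: "{1..X} = {1..U} \<union> {U<..X}" "{1..U} \<inter> {U<..X} = {}" using UX by auto
  have "- (s * ln (real (Suc U))) \<le> - (\<epsilon> * v)"
  proof -
    have "\<epsilon> * l = ln (real p powr \<epsilon>)" using p by (simp add: ln_powr l_def)
    also have "\<dots> \<le> ln (real (Suc U))" using e p unfolding U(2) by (intro ln_mono) auto
    finally have "s * (\<epsilon> * l) \<le> s * ln (real (Suc U))" using s by (intro mult_left_mono) auto
    then show ?thesis using sl by (simp add: mult.left_commute)
  qed
  then have eSU: "exp (- (s * ln (real (Suc U)))) \<le> exp (- (\<epsilon> * v))" by simp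
  \<comment> \<open>The tail telescopes from U rather than U + 1; since U + 1 <= 2 U and s <= 1,
    this loses at most a factor exp 1 <= 3.\<close>
  have eU: "exp (- (s * ln (real U))) \<le> 3 * exp (- (\<epsilon> * v))"
  proof -
    have "real (Suc U) \<le> 2 * real U" using U by simp
    then have "ln (real (Suc U)) \<le> ln (2 * real U)" using U by (intro ln_mono) auto
    also have "\<dots> \<le> 1 + ln (real U)" using U ln_2_less_1 by (simp add: ln_mult)
    finally have "s * ln (real (Suc U)) \<le> s * (1 + ln (real U))" using s by (intro mult_left_mono) auto
    then have "- (s * ln (real U)) \<le> 1 + - (s * ln (real (Suc U)))" using s by (simp add: distrib_left)
    then have "exp (- (s * ln (real U))) \<le> exp 1 * exp (- (s * ln (real (Suc U))))"
      unfolding exp_add[symmetric] by simp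
    also have "\<dots> \<le> 3 * exp (- (\<epsilon> * v))" using eSU exp_le by (intro mult_mono) auto
    finally show ?thesis .
  qed
  have lo: "1 - exp (- (\<epsilon> * v)) \<le> s * (\<Sum>n=1..U. r n)"
    using exp_neg_ln_sum_bounds(1)[OF s(1), of U] eSU unfolding r_def by linarith
  have hi: "s * (\<Sum>n\<in>{U<..X}. r n) \<le> 3 * exp (- (\<epsilon> * v))"
    using exp_neg_ln_sum_bounds(2)[OF s(1) U(1) UX] eU exp_gt_zero[of "- (s * ln (real X))"] unfolding r_def by linarith
  have total: "(\<Sum>n=1..X. legendre p n * r n) = (\<Sum>n=1..U. legendre p n * r n) + (\<Sum>n\<in>{U<..X}. legendre p n * r n)"
    unfolding split(1) by (rule sum.union_disjoint) (use split(2) in auto)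
  have head: "(\<Sum>n=1..U. legendre p n * r n) = (\<Sum>n=1..U. r n)"
  proof (rule sum.cong[OF refl])
    fix n assume "n \<in> {1..U}"
    then have "0 < n" "n < least_nonres p" using U(2) by auto
    from legendre_eq_1_below_least_nonres[OF p this] show "legendre p n * r n = r n" by simp
  qed
  have tail: "- (\<Sum>n\<in>{U<..X}. r n) \<le> (\<Sum>n\<in>{U<..X}. legendre p n * r n)"
    unfolding sum_negf[symmetric]
  proof (rule sum_mono)
    fix n
    have "- 1 * r n \<le> legendre p n * r n"
      using abs_legendre_le[of p n] by (intro mult_right_mono r0) linarith
    then show "- r n \<le> legendre p n * r n" by simp
  qed
  have "(\<Sum>n=1..U. r n) - (\<Sum>n\<in>{U<..X}. r n) \<le> (\<Sum>n=1..X. legendre p n * r n)"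
    using total head tail by linarith
  then have "s * ((\<Sum>n=1..U. r n) - (\<Sum>n\<in>{U<..X}. r n)) \<le> s * (\<Sum>n=1..X. legendre p n * r n)"
    using s by (intro mult_left_mono) auto
  then have "1 - 4 * exp (- (\<epsilon> * v)) \<le> s * (\<Sum>n=1..X. legendre p n * r n)"
    using lo hi by (simp add: right_diff_distrib)
  then have "(1 - 4 * exp (- (\<epsilon> * v))) / v \<le> s * (\<Sum>n=1..X. legendre p n * r n) / v"
    using v by (intro divide_right_mono) auto
  also have "\<dots> = (\<Sum>n=1..X. legendre p n * r n) / l" using v l by (simp add: s_def)
  finally show "(1 - 4 * exp (- (\<epsilon> * v))) / v \<le> Re (genfun p (legendre p) (- of_real v))"
    unfolding gf by simp
  have "\<bar>\<Sum>n=1..X. legendre p n * r n\<bar> \<le> (\<Sum>n=1..X. r n)"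
  proof (rule order_trans[OF sum_abs sum_mono])
    fix n show "\<bar>legendre p n * r n\<bar> \<le> r n"
      using mult_right_mono[OF abs_legendre_le[of p n] r0[of n]] r0[of n] by (simp add: abs_mult)
  qed
  also have "(\<Sum>n=1..X. r n) = 1 + (\<Sum>n\<in>{1<..X}. r n)"
  proof -
    have "{1..X} = insert 1 {1<..X}" using U UX by auto
    then show ?thesis by (simp add: r_def)
  qed
  also have "\<dots> \<le> 1 + 1 / s"
  proof -
    have "s * (\<Sum>n\<in>{1<..X}. r n) \<le> exp (- (s * ln (real 1))) - exp (- (s * ln (real X)))"
      unfolding r_def using U UX by (intro exp_neg_ln_sum_bounds(2)[OF s(1)]) auto
    also have "\<dots> \<le> 1" by simp
    finally have "s * (\<Sum>n\<in>{1<..X}. r n) \<le> 1" .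
    then show ?thesis using s by (simp add: field_simps)
  qed
  also have "\<dots> \<le> 2 / s" using s by (simp add: field_simps)
  finally have "\<bar>\<Sum>n=1..X. legendre p n * r n\<bar> / l \<le> 2 / s / l" using l by (intro divide_right_mono) auto
  also have "2 / s / l = 2 / v" using l v by (simp add: s_def)
  finally show "norm (genfun p (legendre p) (- of_real v)) \<le> 2 / v"
    unfolding gf norm_of_real using l by simp
qed

section \<open>Passage to the limit\<close>

lemma montel_exponential_type:
  fixes F :: "nat \<Rightarrow> complex \<Rightarrow> complex"
  assumes "\<And>i. F i holomorphic_on UNIV" "\<And>i z. norm (F i z) \<le> K * exp (B * norm z)"
  shows "\<exists>g r. g holomorphic_on UNIV \<and> strict_mono (r :: nat \<Rightarrow> nat) \<and> (\<forall>z. (\<lambda>n. F (r n) z) \<longlonglongrightarrow> g z)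
    \<and> (\<forall>z d. uniform_limit (cball z d) (\<lambda>n. F (r n)) g sequentially)"
proof -
  have bd: "\<exists>M. \<forall>h\<in>range F. \<forall>z\<in>L. norm (h z) \<le> M" if L: "compact L" for L :: "complex set"
  proof -
    obtain b where b: "\<And>z. z \<in> L \<Longrightarrow> norm z \<le> b" using compact_imp_bounded[OF L] by (auto simp: bounded_iff)
    have "norm (F i z) \<le> \<bar>K\<bar> * exp (\<bar>B\<bar> * b)" if "z \<in> L" for i z
    proof -
      have "B * norm z \<le> \<bar>B\<bar> * b" using b[OF that] by (intro mult_mono) auto
      then have "K * exp (B * norm z) \<le> \<bar>K\<bar> * exp (\<bar>B\<bar> * b)" by (intro mult_mono) auto
      then show ?thesis using assms(2)[of i z] by linarith
    qed
    then show ?thesis by blast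
  qed
  obtain g r where g: "g holomorphic_on UNIV" "strict_mono (r :: nat \<Rightarrow> nat)"
    "\<And>x. x \<in> UNIV \<Longrightarrow> ((\<lambda>n. F (r n) x) \<longlongrightarrow> g x) sequentially"
    "\<And>K. \<lbrakk>compact K; K \<subseteq> UNIV\<rbrakk> \<Longrightarrow> uniform_limit K (F \<circ> r) g sequentially"
    by (rule Montel[of UNIV "range F" F]) (use assms(1) bd in auto)
  show ?thesis
    using g(1-3) g(4)[OF compact_cball] by (intro exI[of _ g] exI[of _ r]) (simp add: o_def)
qed

text \<open>The factor K depends only on z and C, so kappa can be chosen after it;
  \<open>i < P i\<close> carries the primes past every threshold p0.\<close>

lemma genfun_deriv_limit:
  assumes EH: "elliott_halberstam" and e: "0 < e" "e \<le> 1"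
    and cheb: "\<And>N. (\<Sum>n=1..N. mangoldt n) \<le> C * real N" "C \<ge> 1"
    and P: "\<And>i. prime (P i)" "\<And>i. P i > 2" "\<And>i. real (P i) powr e < real (least_nonres (P i))" "\<And>i. i < P i"
  shows "(\<lambda>i. deriv (genfun (P i) (legendre (P i))) z
       - genfun (P i) (\<lambda>n. legendre (P i) n * mangoldt n) z * genfun (P i) (legendre (P i)) z) \<longlonglongrightarrow> 0"
proof (rule LIMSEQ_I)
  fix \<eta> :: real assume \<eta>: "\<eta> > 0"
  define K where "K = 7 * (9 + C) * ((norm z + 1) * exp (norm z + 1) * exp (4 * norm z)) * exp (4 * norm z)"
  have K: "K > 0" unfolding K_def using cheb(2) by (intro mult_pos_pos) (auto intro: add_nonneg_pos)
  define \<kappa> where "\<kappa> = \<eta> / (2 * K)"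
  have \<kappa>: "\<kappa> > 0" using \<eta> K by (simp add: \<kappa>_def)
  obtain p0 where p0: "\<And>p N. p \<ge> p0 \<Longrightarrow> prime p \<Longrightarrow> p > 2 \<Longrightarrow> real p powr e < real (least_nonres p) \<Longrightarrow>
     p ^ 2 \<le> N \<Longrightarrow> N \<le> p ^ 4 \<Longrightarrow> \<bar>\<Sum>n=1..N. legendre p n * mangoldt n\<bar> \<le> \<kappa> * real N"
    using sum_mangoldt_legendre_small[OF EH e \<kappa>] by blast
  show "\<exists>no. \<forall>n\<ge>no. norm (deriv (genfun (P n) (legendre (P n))) z
       - genfun (P n) (\<lambda>m. legendre (P n) m * mangoldt m) z * genfun (P n) (legendre (P n)) z - 0) < \<eta>"
  proof (intro exI[of _ "max p0 (nat \<lceil>1 / \<kappa>\<rceil>)"] allI impI)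
    fix n assume n: "max p0 (nat \<lceil>1 / \<kappa>\<rceil>) \<le> n"
    have "1 / \<kappa> \<le> real (P n)" using n P(4)[of n] real_nat_ceiling_ge[of "1 / \<kappa>"] by linarith
    then have "1 / real (P n) \<le> \<kappa>" using \<kappa> P(2)[of n] by (simp add: field_simps)
    then have "norm (deriv (genfun (P n) (legendre (P n))) z
       - genfun (P n) (\<lambda>m. legendre (P n) m * mangoldt m) z * genfun (P n) (legendre (P n)) z) \<le> \<kappa> * K"
      unfolding K_def using n P[of n] \<kappa> by (intro genfun_deriv_approx cheb p0) auto
    also have "\<dots> < \<eta>" using K \<eta> by (simp add: \<kappa>_def)
    finally show "norm (deriv (genfun (P n) (legendre (P n))) z
       - genfun (P n) (\<lambda>m. legendre (P n) m * mangoldt m) z * genfun (P n) (legendre (P n)) z - 0) < \<eta>" by simp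
  qed
qed

text \<open>The subsequence for c is taken inside the one for G, so both limits exist along q.
  Uniform convergence on discs carries the derivatives to the limit, where the differential equation
  becomes exact.\<close>

lemma no_large_least_nonres_sequence:
  assumes EH: "elliott_halberstam" and e: "0 < e" "e \<le> 1"
    and P: "\<And>i. prime (P i)" "\<And>i. P i > 2" "\<And>i. real (P i) powr e < real (least_nonres (P i))" "\<And>i. i < P i"
  shows False
proof -
  obtain C where cheb: "C \<ge> 1" "\<And>N. (\<Sum>n=1..N. mangoldt n) \<le> C * real N"
    using chebyshev_upper[OF EH] by blast
  define S where "S = (\<lambda>i. genfun (P i) (legendre (P i)))"
  define T where "T = (\<lambda>i. genfun (P i) (\<lambda>n. legendre (P i) n * mangoldt n))"
  have holS: "S i holomorphic_on UNIV" and holT: "T i holomorphic_on UNIV" for i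
    unfolding S_def T_def by (intro holomorphic_genfun P)+
  have bS: "norm (S i z) \<le> 5 * exp (4 * norm z)" for i z
    unfolding S_def by (rule norm_genfun_le[OF P(2), where u = "\<lambda>_. 1"]) (use abs_legendre_le harm_pow4_le[OF P(2)] in auto)
  have bT: "norm (T i z) \<le> (4 + C) * exp (4 * norm z)" for i z
    unfolding T_def by (rule norm_genfun_le[OF P(2) abs_legendre_mangoldt_le mangoldt_pow4_le[OF P(2) cheb(2,1)]])
  from montel_exponential_type[of S, OF holS bS]
  obtain G r where "G holomorphic_on UNIV \<and> strict_mono (r :: nat \<Rightarrow> nat) \<and> (\<forall>z. (\<lambda>n. S (r n) z) \<longlonglongrightarrow> G z)
    \<and> (\<forall>z d. uniform_limit (cball z d) (\<lambda>n. S (r n)) G sequentially)" by (elim exE)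
  then have G: "G holomorphic_on UNIV" "strict_mono r" "\<And>z. (\<lambda>n. S (r n) z) \<longlonglongrightarrow> G z"
    "\<And>z d. uniform_limit (cball z d) (\<lambda>n. S (r n)) G sequentially" by simp_all
  from montel_exponential_type[of "\<lambda>n. T (r n)", OF holT bT]
  obtain c t where "c holomorphic_on UNIV \<and> strict_mono (t :: nat \<Rightarrow> nat) \<and> (\<forall>z. (\<lambda>n. T (r (t n)) z) \<longlonglongrightarrow> c z)
    \<and> (\<forall>z d. uniform_limit (cball z d) (\<lambda>n. T (r (t n))) c sequentially)" by (elim exE)
  then have c: "c holomorphic_on UNIV" "strict_mono t" "\<And>z. (\<lambda>n. T (r (t n)) z) \<longlonglongrightarrow> c z" by simp_all
  define q where "q = (\<lambda>n. r (t n))"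
  have q: "strict_mono q" unfolding q_def using strict_mono_o[OF G(2) c(2)] by (simp add: o_def)
  have qge: "n \<le> q n" for n by (rule seq_suble[OF q])
  have limG: "(\<lambda>n. S (q n) z) \<longlonglongrightarrow> G z" for z
    unfolding q_def using LIMSEQ_subseq_LIMSEQ[OF G(3) c(2)] by (simp add: o_def)
  have limU: "uniform_limit (cball z d) (\<lambda>n. S (q n)) G sequentially" for z d
    unfolding q_def by (rule filterlim_compose[OF G(4) filterlim_subseq[OF c(2)]])
  have ode: "(G has_field_derivative c z * G z) (at z)" for z
  proof -
    have "\<exists>g'. \<forall>x\<in>UNIV. (G has_field_derivative g' x) (at x) \<and> ((\<lambda>n. deriv (S (q n)) x) \<longlongrightarrow> g' x) sequentially"
    proof (rule has_complex_derivative_uniform_sequence[OF open_UNIV])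
      show "(S (q n) has_field_derivative deriv (S (q n)) x) (at x)" for n x
        using holomorphic_derivI[OF holS open_UNIV] by simp
      show "\<exists>d. 0 < d \<and> cball x d \<subseteq> UNIV \<and> uniform_limit (cball x d) (\<lambda>n. S (q n)) G sequentially" for x
        using limU by (intro exI[of _ 1]) auto
    qed
    then obtain g' where g': "(G has_field_derivative g' z) (at z)" "(\<lambda>n. deriv (S (q n)) z) \<longlonglongrightarrow> g' z" by blast
    have "(\<lambda>i. deriv (S i) z - T i z * S i z) \<longlonglongrightarrow> 0"
      unfolding S_def T_def by (rule genfun_deriv_limit[OF EH e cheb(2,1) P])
    from LIMSEQ_subseq_LIMSEQ[OF this q]
    have "(\<lambda>n. deriv (S (q n)) z - T (q n) z * S (q n) z) \<longlonglongrightarrow> 0" by (simp add: o_def)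
    moreover have "(\<lambda>n. T (q n) z * S (q n) z) \<longlonglongrightarrow> c z * G z"
      using c(3) limG unfolding q_def by (intro tendsto_mult) auto
    ultimately have "(\<lambda>n. (deriv (S (q n)) z - T (q n) z * S (q n) z) + T (q n) z * S (q n) z) \<longlonglongrightarrow> 0 + c z * G z"
      by (rule tendsto_add)
    then have "g' z = c z * G z" using LIMSEQ_unique[OF g'(2)] by simp
    then show ?thesis using g'(1) by simp
  qed
  have growth: "norm (G z) \<le> 5 * exp (4 * norm z)" for z
    using tendsto_norm[OF limG[of z]] by (rule LIMSEQ_le_const2) (use bS in auto)
  have axis: "(1 - 4 * exp (- (e * v))) / v \<le> Re (G (- of_real v))" "norm (G (- of_real v)) \<le> 2 / v"
    if v: "v > 0" for v
  proof -
    have ev: "v \<le> ln (real (P (q n)))" if n: "n \<ge> nat \<lceil>exp v\<rceil>" for n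
    proof -
      have "exp v \<le> real (P (q n))"
        using n P(4)[of "q n"] qge[of n] real_nat_ceiling_ge[of "exp v"] by linarith
      then show ?thesis using P(2)[of "q n"] by (simp add: ln_ge_iff)
    qed
    show "(1 - 4 * exp (- (e * v))) / v \<le> Re (G (- of_real v))"
      using tendsto_Re[OF limG[of "- of_real v"]]
    proof (rule LIMSEQ_le_const)
      show "\<exists>N. \<forall>n\<ge>N. (1 - 4 * exp (- (e * v))) / v \<le> Re (S (q n) (- of_real v))"
        unfolding S_def using genfun_negative_axis(1)[OF P(1,2) e(1) P(3) v ev] by blast
    qed
    show "norm (G (- of_real v)) \<le> 2 / v"
      using tendsto_norm[OF limG[of "- of_real v"]]
    proof (rule LIMSEQ_le_const2)
      show "\<exists>N. \<forall>n\<ge>N. norm (S (q n) (- of_real v)) \<le> 2 / v"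
        unfolding S_def using genfun_negative_axis(2)[OF P(1,2) e(1) P(3) v ev] by blast
    qed
  qed
  \<comment> \<open>From here on 4 exp (-e v) <= 1/2.\<close>
  define v0 where "v0 = ln 8 / e"
  have lower: "1 / (2 * v) \<le> norm (G (- of_real v))" if "v \<ge> v0" "v > 0" for v
  proof -
    have "ln 8 \<le> e * v" using that e by (simp add: v0_def field_simps)
    then have "exp (- (e * v)) \<le> exp (- ln 8)" by simp
    also have "\<dots> = 1 / 8" by (simp add: exp_minus)
    finally have "(1 / 2) / v \<le> (1 - 4 * exp (- (e * v))) / v" using that by (intro divide_right_mono) auto
    also have "\<dots> \<le> Re (G (- of_real v))" using that axis by blast
    also have "\<dots> \<le> norm (G (- of_real v))" by (rule complex_Re_le_cmod)
    finally show ?thesis by simp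
  qed
  have v0: "v0 > 0" using e by (simp add: v0_def)
  have nz: "G (- of_real v0) \<noteq> 0" using lower[of v0] v0 by auto
  obtain \<alpha> \<beta> where G_exp: "\<And>z. G z = exp (\<beta> + \<alpha> * z)"
    using zero_free_exponential_type[OF G(1) c(1) ode growth nz] by blast
  have G0: "norm (G 0) > 0" by (simp add: G_exp)
  \<comment> \<open>The comparison below yields v |G 0| <= 16, which this choice violates.\<close>
  define v where "v = v0 + 17 / norm (G 0)"
  have v: "v \<ge> v0" "v > 0" using v0 G0 by (auto simp: v_def intro: add_pos_pos)
  \<comment> \<open>This holds for the exponential of any affine function. By the bounds on the
    axis, the left side is at least |G 0| / (4 v) and the right at most 4 / v^2.\<close>
  have "G (- of_real (2 * v)) * G 0 = G (- of_real v) * G (- of_real v)"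
    by (simp add: G_exp algebra_simps flip: exp_add)
  then have eq: "norm (G (- of_real (2 * v))) * norm (G 0) = norm (G (- of_real v)) * norm (G (- of_real v))"
    by (metis norm_mult)
  have "1 / (2 * (2 * v)) * norm (G 0) \<le> norm (G (- of_real (2 * v))) * norm (G 0)"
    using v G0 by (intro mult_right_mono lower) auto
  also have "\<dots> \<le> (2 / v) * (2 / v)"
    unfolding eq using v axis(2) by (intro mult_mono) auto
  finally have "v * norm (G 0) \<le> 16" using v by (simp add: field_simps)
  moreover have "v * norm (G 0) = v0 * norm (G 0) + 17" using G0 by (simp add: v_def distrib_right)
  moreover have "v0 * norm (G 0) > 0" using v0 G0 by simp
  ultimately show False by linarith
qed

text \<open>Modulo 2 every number is a square, so that \<open>least_nonres 2\<close> is a least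
  element of an empty set; hence p > 2.\<close>

theorem theorem1p3:
  assumes "elliott_halberstam"
  shows "\<forall>\<epsilon>::real. \<epsilon> > 0 \<longrightarrow>
           (\<exists>C::real. \<forall>p::nat. prime p \<and> p > 2 \<longrightarrow>
              real (least_nonres p) \<le> C * real p powr \<epsilon>)"
proof (intro allI impI, rule ccontr)
  fix \<epsilon> :: real assume \<epsilon>: "\<epsilon> > 0"
  assume "\<not> (\<exists>C::real. \<forall>p::nat. prime p \<and> p > 2 \<longrightarrow> real (least_nonres p) \<le> C * real p powr \<epsilon>)"
  \<comment> \<open>Refuting the constant i + 1 also gives i + 1 < n(p) < p, so these primes tend to
    infinity.\<close>
  then have "\<exists>p. prime p \<and> p > 2 \<and> real (i + 1) * real p powr \<epsilon> < real (least_nonres p)" for i :: nat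
    by (meson not_le)
  then obtain P where P: "\<And>i. prime (P i)" "\<And>i. P i > 2"
    "\<And>i::nat. real (i + 1) * real (P i) powr \<epsilon> < real (least_nonres (P i))" by metis
  \<comment> \<open>The estimates assume an exponent at most 1, which ensures N^(e/4) <= p; the
    lower bound on n(p) survives a smaller exponent.\<close>
  define e where "e = min \<epsilon> 1"
  have e: "0 < e" "e \<le> 1" "e \<le> \<epsilon>" using \<epsilon> by (auto simp: e_def)
  have P1: "1 \<le> real (P i) powr \<epsilon>" for i using P(2)[of i] \<epsilon> by (intro ge_one_powr_ge_zero) auto
  have "real (P i) powr e < real (least_nonres (P i))" for i
  proof -
    have "real (P i) powr e \<le> 1 * real (P i) powr \<epsilon>" using e P(2)[of i] by (simp add: powr_mono)
    also have "\<dots> \<le> real (i + 1) * real (P i) powr \<epsilon>" by (intro mult_right_mono) auto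
    finally show ?thesis using P(3)[of i] by linarith
  qed
  moreover have "i < P i" for i
  proof -
    have "real (i + 1) * 1 \<le> real (i + 1) * real (P i) powr \<epsilon>" by (intro mult_left_mono P1) auto
    also have "\<dots> < real (least_nonres (P i))" by (rule P(3))
    also have "\<dots> < real (P i)" using least_nonres_less[OF P(1,2)] by simp
    finally show ?thesis by simp
  qed
  ultimately show False by (rule no_large_least_nonres_sequence[OF assms e(1,2) P(1,2)])
qed

end
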